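(* Consider a Kähler metric $g$ in an open subset $\Omega$ of $\mathbb{C}^2$ such that all geodesics of $g$ are parts of circles (or straight lines). Then, up to a complex projective transformation, $g$ is some Fubini metric.
   Context: Metrics are Riemannian metrics. A Riemannian metric $g$ on an open subset of $\mathbb{C}^n$ is Hermitian if $g(ix,iy)=g(x,y)$ for any two tangent vectors $x,y$ at the same point; it is Kähler if moreover the 2-form $\omega(x,y)=g(ix,y)$ is closed, $d\omega=0$. Circles are ordinary round circles of the Euclidean space $\mathbb{C}^2=\mathbb{R}^4$; geodesics are the real geodesics of $g$, regarded as curves. A complex projective transformation is a map induced on $\mathbb{CP}^n$ by an invertible complex linear map of $\mathbb{C}^{n+1}$, where $\mathbb{C}^n\subset\mathbb{CP}^n$ is the affine chart $\{Z_0=1\}$; here $n=2$. Fubini metrics: for $\alpha\in\mathbb{R}$ consider on $\mathbb{C}^{n+1}$ the form $H=Z_0\bar Z_0+\alpha\sum_{j=1}^nZ_j\bar Z_j$, with associated Hermitian product $\langle\cdot,\cdot\rangle$, and the Fubini space $F=\{H=1\}/U(1)=\{H>0\}/\mathbb{C}^*$. For $\alpha\neq0$, $F$ carries the quotient metric induced by $H$ (with a minus sign if $\alpha<0$) from the pseudosphere $\{H=1\}$; for $\alpha=0$, $F=\mathbb{C}^n$ carries the standard Euclidean metric. Intersecting complex lines in $\{H>0\}$ with $\{Z_0=1\}$ identifies $F$ with an affine model: the whole of $\mathbb{C}^n$ for $\alpha=0$, an affine chart $\mathbb{C}^n$ of $\mathbb{CP}^n$ for $\alpha>0$, an open ball for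 $\alpha<0$. The metrics of Fubini spaces written in these affine models are called the Fubini metrics. For $\alpha\neq0$, the squared length of a tangent vector $v$ at $z$ is, with $X=(1,z)$ and $V=(0,v)$, $$|v|^2=\operatorname{sign}(\alpha)\,\frac{\langle V,V\rangle\langle X,X\rangle-\langle X,V\rangle\langle V,X\rangle}{\langle X,X\rangle^2}.$$ (For $\alpha>0$ this is the Fubini–Study metric restricted to an affine chart; for $\alpha<0$ the complex hyperbolic metric in the ball model.)
   Formalization: The formal theorem concludes that g is a positive constant times a Fubini metric, up to a complex projective transformation, on each connected component of Ω; 2·(Fubini–Study), or different Fubini metrics on disjoint balls, refute the literal claim. *)

theory Defs
  imports "HOL-Analysis.Analysis"
begin

primrec Ck_on :: "nat \<Rightarrow> ('a::euclidean_space \<Rightarrow> 'b::real_normed_vector) \<Rightarrow> 'a set \<Rightarrow> bool" where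
  "Ck_on 0 f S = continuous_on S f"
| "Ck_on (Suc k) f S =
     (f differentiable_on S \<and> (\<forall>v. Ck_on k (\<lambda>x. frechet_derivative f (at x) v) S))"

(* Only used for open S, where "differentiable_on" and "at x" agree. *)
definition smooth_on :: "('a::euclidean_space \<Rightarrow> 'b::real_normed_vector) \<Rightarrow> 'a set \<Rightarrow> bool" where
  "smooth_on f S \<longleftrightarrow> (\<forall>k. Ck_on k f S)"

(* A field of bilinear forms is a function g, where g z v w is its value at the point z on the
   tangent vectors v and w. *)
definition riemannian_metric ::
  "'a::euclidean_space set \<Rightarrow> ('a \<Rightarrow> 'a \<Rightarrow> 'a \<Rightarrow> real) \<Rightarrow> bool" where
  "riemannian_metric \<Omega> g \<longleftrightarrow>
     (\<forall>v w. smooth_on (\<lambda>z. g z v w) \<Omega>) \<and>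
     (\<forall>z\<in>\<Omega>. bilinear (g z) \<and> (\<forall>v w. g z v w = g z w v) \<and> (\<forall>v. v \<noteq> 0 \<longrightarrow> g z v v > 0))"

definition hermitian_metric ::
  "(complex^'n) set \<Rightarrow> (complex^'n \<Rightarrow> complex^'n \<Rightarrow> complex^'n \<Rightarrow> real) \<Rightarrow> bool" where
  "hermitian_metric \<Omega> g \<longleftrightarrow> riemannian_metric \<Omega> g \<and>
     (\<forall>z\<in>\<Omega>. \<forall>v w. g z (\<i> *s v) (\<i> *s w) = g z v w)"

definition dir_deriv :: "('a::euclidean_space \<Rightarrow> real) \<Rightarrow> 'a \<Rightarrow> 'a \<Rightarrow> real" where
  "dir_deriv f z u = frechet_derivative f (at z) u"

(* Exterior derivative of a 2-form, evaluated on constant vector fields (so the Lie bracket terms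
   of the invariant formula vanish). *)
definition ext_deriv2 ::
  "('a::euclidean_space \<Rightarrow> 'a \<Rightarrow> 'a \<Rightarrow> real) \<Rightarrow> 'a \<Rightarrow> 'a \<Rightarrow> 'a \<Rightarrow> 'a \<Rightarrow> real" where
  "ext_deriv2 \<omega> z u v w =
     dir_deriv (\<lambda>x. \<omega> x v w) z u - dir_deriv (\<lambda>x. \<omega> x u w) z v + dir_deriv (\<lambda>x. \<omega> x u v) z w"

definition fundamental_form ::
  "(complex^'n \<Rightarrow> complex^'n \<Rightarrow> complex^'n \<Rightarrow> real) \<Rightarrow> complex^'n \<Rightarrow> complex^'n \<Rightarrow> complex^'n \<Rightarrow> real"
  where "fundamental_form g z v w = g z (\<i> *s v) w"

definition kaehler_metric ::
  "(complex^'n) set \<Rightarrow> (complex^'n \<Rightarrow> complex^'n \<Rightarrow> complex^'n \<Rightarrow> real) \<Rightarrow> bool" where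
  "kaehler_metric \<Omega> g \<longleftrightarrow> hermitian_metric \<Omega> g \<and>
     (\<forall>z\<in>\<Omega>. \<forall>u v w. ext_deriv2 (fundamental_form g) z u v w = 0)"

(* Levi-Civita connection: the covariant derivative of the constant vector field v in the
   direction u at z, characterised by the Koszul formula. In coordinates its components are
   Gamma^k_ij u^i v^j. *)
definition christoffel ::
  "('a::euclidean_space \<Rightarrow> 'a \<Rightarrow> 'a \<Rightarrow> real) \<Rightarrow> 'a \<Rightarrow> 'a \<Rightarrow> 'a \<Rightarrow> 'a" where
  "christoffel g z u v = (THE a. \<forall>w. g z a w =
     (dir_deriv (\<lambda>x. g x v w) z u + dir_deriv (\<lambda>x. g x u w) z v - dir_deriv (\<lambda>x. g x u v) z w) / 2)"

(* Affinely parametrised geodesics, \<gamma>'' + \<Gamma>(\<gamma>', \<gamma>') = 0, on an open interval I. Constant curves are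
   not excluded. *)
definition geodesic_on ::
  "'a::euclidean_space set \<Rightarrow> ('a \<Rightarrow> 'a \<Rightarrow> 'a \<Rightarrow> real) \<Rightarrow> real set \<Rightarrow> (real \<Rightarrow> 'a) \<Rightarrow> bool" where
  "geodesic_on \<Omega> g I \<gamma> \<longleftrightarrow> open I \<and> is_interval I \<and> \<gamma> ` I \<subseteq> \<Omega> \<and>
     (\<exists>\<gamma>'. \<forall>t\<in>I. (\<gamma> has_vector_derivative \<gamma>' t) (at t) \<and>
        (\<gamma>' has_vector_derivative - christoffel g (\<gamma> t) (\<gamma>' t) (\<gamma>' t)) (at t))"

definition round_circle :: "'a::euclidean_space set \<Rightarrow> bool" where
  "round_circle S \<longleftrightarrow> (\<exists>c u v r. 0 < r \<and> norm u = 1 \<and> norm v = 1 \<and> u \<bullet> v = 0 \<and>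
     S = range (\<lambda>t. c + (r * cos t) *\<^sub>R u + (r * sin t) *\<^sub>R v))"

definition straight_line :: "'a::euclidean_space set \<Rightarrow> bool" where
  "straight_line S \<longleftrightarrow> (\<exists>c u. u \<noteq> 0 \<and> S = range (\<lambda>t. c + t *\<^sub>R u))"

(* Homogeneous coordinates Z_0, Z_1, Z_2 on complex^3 are the components 1, 2, 3. *)
definition homog :: "complex^2 \<Rightarrow> complex^3" where
  "homog z = vector [1, z$1, z$2]"

definition homog_tangent :: "complex^2 \<Rightarrow> complex^3" where
  "homog_tangent v = vector [0, v$1, v$2]"

definition fubini_form :: "real \<Rightarrow> complex^3 \<Rightarrow> complex^3 \<Rightarrow> complex" where
  "fubini_form \<alpha> Z W =
     Z$1 * cnj (W$1) + complex_of_real \<alpha> * (Z$2 * cnj (W$2) + Z$3 * cnj (W$3))"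

definition fubini_model :: "real \<Rightarrow> (complex^2) set" where
  "fubini_model \<alpha> = {z. 0 < Re (fubini_form \<alpha> (homog z) (homog z))}"

(* The real bilinear form polarising the squared length given by v = w. *)
definition fubini_metric :: "real \<Rightarrow> complex^2 \<Rightarrow> complex^2 \<Rightarrow> complex^2 \<Rightarrow> real" where
  "fubini_metric \<alpha> z v w =
     (if \<alpha> = 0 then v \<bullet> w
      else let X = homog z; V = homog_tangent v; W = homog_tangent w in
        sgn \<alpha> * Re ((fubini_form \<alpha> V W * fubini_form \<alpha> X X - fubini_form \<alpha> X W * fubini_form \<alpha> V X)
                    / (fubini_form \<alpha> X X)\<^sup>2))"

(* The transformation of the projective plane induced by an invertible A, read in the affine chart
   Z_0 = 1; z is mapped into the chart iff z lies in proj_dom A. *)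
definition proj_dom :: "complex^3^3 \<Rightarrow> (complex^2) set" where
  "proj_dom A = {z. (A *v homog z) $ 1 \<noteq> 0}"

definition proj_map :: "complex^3^3 \<Rightarrow> complex^2 \<Rightarrow> complex^2" where
  "proj_map A z = (let Y = A *v homog z in vector [Y$2 / Y$1, Y$3 / Y$1])"

definition pullback_metric ::
  "('a::euclidean_space \<Rightarrow> 'a) \<Rightarrow> ('a \<Rightarrow> 'a \<Rightarrow> 'a \<Rightarrow> real) \<Rightarrow> 'a \<Rightarrow> 'a \<Rightarrow> 'a \<Rightarrow> real" where
  "pullback_metric \<phi> h z v w =
     h (\<phi> z) (frechet_derivative \<phi> (at z) v) (frechet_derivative \<phi> (at z) w)"

end

theory Submission
  imports Defs
begin

text \<open>
  Write the metric as the real part of a Hermitian form with coefficient matrix \<open>H\<close>. For a Kaehler metric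
  the acceleration \<open>a = - \<Gamma>(v, v)\<close> of a geodesic is a complex quadratic function of its velocity \<open>v\<close>
  (\<open>kaehler_metric_coefficients\<close>, \<open>koszul\<close>).

  Along a curve contained in a circle or a line, \<open>\<bar>v\<bar>\<^sup>2 j - 3 (v \<bullet> a) a\<close> is parallel to \<open>v\<close>, where \<open>j\<close> is the
  third derivative (\<open>circle_jerk\<close>). Since a geodesic starts in every direction (\<open>geodesic_exists\<close>, which
  rests on a local Picard theorem), this is an identity in \<open>v\<close> and its conjugate. Comparing \<open>v\<close> with \<open>\<i>v\<close>
  isolates the part of \<open>j\<close> that is holomorphic in \<open>v\<close>, and because \<open>v\<close> and its conjugate are algebraically
  independent, what remains forces \<open>\<Gamma>(v, v)\<close> to be a complex multiple of \<open>v\<close> (\<open>jerk_condition_algebra\<close>,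
  \<open>acceleration_along_velocity\<close>). In other words complex lines are totally geodesic.

  The coefficients of the metric now satisfy \<open>\<partial>\<^sub>k H i j = l k * H i j + l i * H k j\<close>. With
  \<open>D = (det H) powr (-1/3)\<close> the matrix \<open>N = D\<^sup>2 H\<close> solves a system without \<open>l\<close>, whose solutions are
  explicit: there is one constant Hermitian form \<open>M\<close> on the dual projective plane such that \<open>N\<close> at \<open>z\<close>,
  on tangent vectors \<open>v\<close> and \<open>w\<close>, is the value of \<open>M\<close> on the lines through \<open>z\<close> in the directions \<open>v\<close> and
  \<open>w\<close> (\<open>codazzi_solution\<close>, \<open>projectively_flat_solution\<close>). As \<open>D = det N\<close>, the form \<open>M\<close> determines the
  metric, and it does so on a whole component because \<open>M\<close> is constant on connected open sets.

  A Fubini metric, pulled back by any projective transformation, has this same shape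
  (\<open>pullback_fubini\<close>). It remains to diagonalise \<open>M\<close>, which is positive on the plane of lines through a
  point of the domain, so that two pivots are positive and the sign of the third is that of \<open>\<alpha>\<close>
  (\<open>two_pivots\<close>, \<open>normal_form_matrix\<close>). The order of the pivots ensures that the affine chart of the
  Fubini space contains the image of the component.
\<close>

section \<open>Local solutions of autonomous differential equations\<close>

text \<open>
  The map sending a curve \<open>x\<close> to \<open>t \<mapsto> x0 + \<integral>\<^sub>0\<^sup>t F(x)\<close> contracts the Banach space of bounded continuous
  curves on the line, once the time is clamped to a short interval \<open>[-T, T]\<close>; its fixed point solves
  the equation. The integral from \<open>0\<close> is taken as a difference of two integrals from \<open>-T\<close>, so that
  negative times need no separate treatment. The constants 3 and 6 leave room for the crude bound by
  the sum of these two integrals, of lengths at most \<open>2T\<close> and \<open>T\<close>.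
\<close>

lemma picard_global:
  fixes F :: "'a::euclidean_space \<Rightarrow> 'a"
  assumes lip: "\<And>x y. norm (F x - F y) \<le> L * norm (x - y)"
    and bd: "\<And>x. norm (F x) \<le> B"
    and T: "0 < T" "6 * T * L \<le> 1" and L: "0 \<le> L"
  obtains x where "x 0 = x0"
    "\<And>t. t \<in> {-T<..<T} \<Longrightarrow> (x has_vector_derivative F (x t)) (at t)"
    "\<And>t. norm (x t - x0) \<le> 3 * T * B"
proof -
  have B: "0 \<le> B" using bd[of undefined] norm_ge_zero order_trans by blast
  have contF: "continuous_on UNIV F"
  proof (rule continuous_on_iff[THEN iffD2], intro ballI allI impI)
    fix x e :: 'a and \<epsilon> :: real assume "\<epsilon> > 0"
    have "dist (F x') (F x) < \<epsilon>" if "dist x' x < \<epsilon> / (L+1)" for x'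
    proof -
      have "dist (F x') (F x) \<le> L * dist x' x" using lip by (simp add: dist_norm)
      also have "\<dots> \<le> (L+1) * dist x' x" by (simp add: mult_right_mono)
      also have "\<dots> < \<epsilon>" using that L by (simp add: field_simps)
      finally show ?thesis .
    qed
    thus "\<exists>d>0. \<forall>x'\<in>UNIV. dist x' x < d \<longrightarrow> dist (F x') (F x) < \<epsilon>"
      using \<open>\<epsilon> > 0\<close> L by (intro exI[of _ "\<epsilon>/(L+1)"]) auto
  qed
  define c where "c t = max (-T) (min T t)" for t :: real
  have c: "c t \<in> {-T..T}" for t using T by (auto simp: c_def)
  have contc: "continuous_on UNIV c" unfolding c_def by (intro continuous_intros)
  define J where "J x t = integral {-T..t} (\<lambda>s. F (x s)) - integral {-T..0} (\<lambda>s. F (x s))"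
    for x :: "real \<Rightarrow> 'a" and t
  have contFx: "continuous_on S (\<lambda>s. F (x s))" if "continuous_on UNIV x" for x :: "real \<Rightarrow> 'a" and S
    using continuous_on_compose2[OF contF that] continuous_on_subset by blast
  have intg: "(\<lambda>s. F (x s)) integrable_on {-T..t}" if "continuous_on UNIV x" for x t
    by (rule integrable_continuous_real, rule contFx[OF that])
  have Jcont: "continuous_on {-T..T} (J x)" if "continuous_on UNIV x" for x
    unfolding J_def using indefinite_integral_continuous_1[OF intg[OF that]]
    by (intro continuous_intros) 
  have ib: "norm (integral {-T..t} f) \<le> 2*T*K"
    if "continuous_on UNIV f" "\<And>s. norm (f s) \<le> K" "t \<in> {-T..T}" for t K and f :: "real \<Rightarrow> 'a"
  proof -
    have K: "0 \<le> K" using that(2)[of 0] norm_ge_zero order_trans by blast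
    have "norm (integral {-T..t} f) \<le> K * (t - (-T))"
      using that by (intro integral_bound) (auto intro: continuous_on_subset)
    also have "\<dots> \<le> K * (2*T)" using K that by (intro mult_left_mono) auto
    finally show ?thesis by (simp add: algebra_simps)
  qed
  have ib0: "norm (integral {-T..0} f) \<le> T*K"
    if "continuous_on UNIV f" "\<And>s. norm (f s) \<le> K" for K and f :: "real \<Rightarrow> 'a"
  proof -
    have "norm (integral {-T..0} f) \<le> K * (0 - (-T))"
      using that T by (intro integral_bound) (auto intro: continuous_on_subset)
    thus ?thesis by (simp add: algebra_simps)
  qed
  (* J x t is the integral of F along x from 0 to t, in a form valid for both signs of t. *)
  have Jb: "norm (J x t) \<le> 3*T*B" if "continuous_on UNIV x" "t \<in> {-T..T}" for x t
  proof -
    have "norm (J x t) \<le> 2*T*B + T*B" unfolding J_def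
      using ib[OF contFx[OF that(1)] bd that(2)] ib0[OF contFx[OF that(1)] bd]
      by (intro order_trans[OF norm_triangle_ineq4]) linarith
    thus ?thesis by (simp add: algebra_simps)
  qed
  have Jl: "norm (J x t - J y t) \<le> 3*T*(L*d)"
    if "continuous_on UNIV x" "continuous_on UNIV y" "t \<in> {-T..T}" "\<And>s. norm (x s - y s) \<le> d" for x y t d
  proof -
    let ?f = "\<lambda>s. F (x s) - F (y s)"
    have cf: "continuous_on UNIV ?f" by (intro continuous_intros contFx that)
    have nf: "norm (?f s) \<le> L * d" for s
      using lip[of "x s" "y s"] mult_left_mono[OF that(4)[of s] L] by linarith
    have eq: "J x t - J y t = integral {-T..t} ?f - integral {-T..0} ?f"
      unfolding J_def by (simp add: Henstock_Kurzweil_Integration.integral_diff intg that)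
    have "norm (J x t - J y t) \<le> 2*T*(L*d) + T*(L*d)" unfolding eq
      using ib[OF cf nf that(3)] ib0[OF cf nf]
      by (intro order_trans[OF norm_triangle_ineq4]) linarith
    thus ?thesis by (simp add: algebra_simps)
  qed
  define P where "P x t = x0 + J (apply_bcontfun x) (c t)" for x :: "real \<Rightarrow>\<^sub>C 'a" and t
  have Pbc: "P x \<in> bcontfun" for x
  proof (rule bcontfun_normI)
    show "continuous_on UNIV (P x)" unfolding P_def
      by (intro continuous_intros continuous_on_compose2[OF Jcont contc]) (use c in auto)
    show "norm (P x t) \<le> norm x0 + 3*T*B" for t
      unfolding P_def using Jb[of "apply_bcontfun x" "c t"] c[of t]
      by (intro order_trans[OF norm_triangle_ineq]) auto
  qed
  define \<Phi> where "\<Phi> x = Bcontfun (P x)" for x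
  have app: "apply_bcontfun (\<Phi> x) = P x" for x
    unfolding \<Phi>_def using Pbc by (simp add: Bcontfun_inverse)
  have "dist (\<Phi> x) (\<Phi> y) \<le> 1/2 * dist x y" for x y
  proof (rule dist_bound)
    fix t
    have "dist (\<Phi> x t) (\<Phi> y t) = norm (J x (c t) - J y (c t))"
      unfolding app P_def by (simp add: dist_norm)
    also have "\<dots> \<le> 3*T*(L*dist x y)"
      using c[of t] dist_bounded[of x _ y] by (intro Jl) (auto simp: dist_norm)
    also have "\<dots> = (6*T*L) * (dist x y / 2)" by simp
    also have "\<dots> \<le> 1 * (dist x y / 2)" using T by (intro mult_right_mono) auto
    finally show "dist (\<Phi> x t) (\<Phi> y t) \<le> 1/2 * dist x y" by simp
  qed
  hence "\<exists>!x. \<Phi> x = x" by (intro banach_fix_type[of "1/2"]) auto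
  then obtain X where X: "\<Phi> X = X" by auto
  define x where "x = apply_bcontfun X"
  have xe: "x t = x0 + J x (c t)" for t using app[of X] X unfolding x_def P_def by metis
  have xc: "continuous_on UNIV x" unfolding x_def by simp
  show thesis
  proof (rule that)
    show "x 0 = x0" using T by (subst xe) (simp add: c_def J_def)
    show "norm (x t - x0) \<le> 3*T*B" for t using Jb[OF xc c] xe[of t] by (simp)
    fix t assume t: "t \<in> {-T<..<T}"
    have "((\<lambda>u. integral {-T..u} (\<lambda>s. F (x s))) has_vector_derivative F (x t)) (at t within {-T..T})"
      using t by (intro integral_has_vector_derivative contFx xc) auto
    hence "((\<lambda>u. x0 + J x u) has_vector_derivative F (x t)) (at t within {-T..T})"
      unfolding J_def by (auto intro!: derivative_eq_intros)
    hence "((\<lambda>u. x0 + J x u) has_vector_derivative F (x t)) (at t)"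
      using t by (metis at_within_Icc_at greaterThanLessThan_iff)
    thus "(x has_vector_derivative F (x t)) (at t)"
    proof (rule has_vector_derivative_transform_within_open)
      show "open {-T<..<T}" by simp
      show "x0 + J x u = x u" if "u \<in> {-T<..<T}" for u using that by (subst xe) (auto simp: c_def)
    qed (use t in auto)
  qed
qed

text \<open>
  Composition of \<open>F\<close> with the nearest-point projection onto the ball, a map with Lipschitz constant 1,
  makes it bounded and Lipschitz everywhere. For a short time the solution of the modified equation
  stays in the ball, where nothing was changed.
\<close>

lemma picard_local:
  fixes F :: "'a::euclidean_space \<Rightarrow> 'a"
  assumes lip: "\<And>x y. x \<in> cball x0 r \<Longrightarrow> y \<in> cball x0 r \<Longrightarrow> norm (F x - F y) \<le> L * norm (x - y)"
    and r: "0 < r" and L: "0 \<le> L"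
  obtains x T where "0 < T" "x 0 = x0"
    "\<And>t. t \<in> {-T<..<T} \<Longrightarrow> x t \<in> cball x0 r \<and> (x has_vector_derivative F (x t)) (at t)"
proof -
  define p where "p = closest_point (cball x0 r)"
  have ne: "cball x0 r \<noteq> {}" using r by auto
  have p: "p x \<in> cball x0 r" for x unfolding p_def using closest_point_in_set[OF closed_cball ne] .
  have pid: "p x = x" if "x \<in> cball x0 r" for x unfolding p_def using closest_point_self[OF that] .
  define B where "B = norm (F x0) + L * r"
  have B: "B \<ge> 0" unfolding B_def using L r by simp
  define T where "T = min (1 / (6 * (L+1))) (r / (3 * (B+1)))"
  have T0: "0 < T" unfolding T_def using L B r by simp
  have "6 * T * L \<le> 6 * T * (L+1)" using T0 by simp
  also have "\<dots> \<le> 6 * (1 / (6 * (L+1))) * (L+1)" unfolding T_def using L by (intro mult_right_mono mult_left_mono) auto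
  finally have T1: "6 * T * L \<le> 1" using L by simp
  have "3 * T * B \<le> 3 * T * (B+1)" using T0 by simp
  also have "\<dots> \<le> 3 * (r / (3 * (B+1))) * (B+1)" unfolding T_def using B by (intro mult_right_mono mult_left_mono) auto
  also have "\<dots> = r" using B by (simp add: field_simps)
  finally have T2: "3 * T * B \<le> r" .
  have l: "norm (F (p x) - F (p y)) \<le> L * norm (x - y)" for x y
  proof -
    have "norm (p x - p y) \<le> norm (x - y)"
      unfolding p_def using closest_point_lipschitz[OF convex_cball closed_cball ne] by (simp add: dist_norm)
    thus ?thesis using lip[OF p[of x] p[of y]] mult_left_mono[OF _ L] by (meson order_trans)
  qed
  have bd: "norm (F (p x)) \<le> B" for x
  proof -
    have "norm (F (p x) - F x0) \<le> L * norm (p x - x0)" using r by (intro lip p) auto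
    also have "\<dots> \<le> L * r" using p[of x] L by (intro mult_left_mono) (auto simp: dist_norm norm_minus_commute)
    finally show ?thesis unfolding B_def using norm_triangle_sub[of "F (p x)" "F x0"] by linarith
  qed
  obtain x where x: "x 0 = x0" "\<And>t. t \<in> {-T<..<T} \<Longrightarrow> (x has_vector_derivative F (p (x t))) (at t)"
    "\<And>t. norm (x t - x0) \<le> 3 * T * B"
    using picard_global[of "\<lambda>x. F (p x)" L B T x0] l bd T0 T1 L by metis
  have "x t \<in> cball x0 r" for t using x(3)[of t] T2 by (auto simp: dist_norm norm_minus_commute)
  hence "\<And>t. t \<in> {-T<..<T} \<Longrightarrow> x t \<in> cball x0 r \<and> (x has_vector_derivative F (x t)) (at t)"
    using x(2) pid by metis
  from that[of T x, OF T0 x(1) this] show thesis by blast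
qed

section \<open>Functions of class C^k\<close>

abbreviation "FD f x \<equiv> frechet_derivative f (at x)"

lemma FD_eqI: "(f has_derivative f') (at x) \<Longrightarrow> FD f x = f'"
  using frechet_derivative_at by fastforce

lemma FD_works: "f differentiable (at x) \<Longrightarrow> (f has_derivative FD f x) (at x)"
  by (simp add: frechet_derivative_works)

lemma differentiable_transform_open:
  assumes "open S" "x \<in> S" "\<And>y. y \<in> S \<Longrightarrow> f y = g y" "f differentiable at x"
  shows "g differentiable at x" "FD g x = FD f x"
proof -
  have "(g has_derivative FD f x) (at x)"
    using has_derivative_transform_within_open[OF FD_works[OF assms(4)] assms(1,2)] assms(3) by blast
  thus "g differentiable at x" "FD g x = FD f x" by (auto simp: differentiable_def FD_eqI)
qed

lemma Ck_cong:
  assumes "open S" "Ck_on k f S" "\<And>x. x \<in> S \<Longrightarrow> f x = g x"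
  shows "Ck_on k g S"
  using assms(2,3)
proof (induction k arbitrary: f g)
  case 0 thus ?case by (simp cong: continuous_on_cong)
next
  case (Suc k)
  have d: "g differentiable at x" "FD g x = FD f x" if "x \<in> S" for x
    using differentiable_transform_open[OF assms(1) that, of f g] Suc.prems that assms(1)
    by (auto simp: differentiable_on_eq_differentiable_at)
  have "Ck_on k (\<lambda>x. FD g x v) S" for v
    by (rule Suc.IH[of "\<lambda>x. FD f x v"]) (use Suc.prems d in auto)
  thus ?case using d assms(1) by (auto simp: differentiable_on_eq_differentiable_at)
qed

text \<open>
  The form in which the class of a composite function is computed: any explicit derivative may stand
  for the Frechet derivative of the definition.
\<close>

lemma Ck_SucI:
  assumes "open S" "\<And>x. x \<in> S \<Longrightarrow> (f has_derivative D x) (at x)" "\<And>v. Ck_on k (\<lambda>x. D x v) S"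
  shows "Ck_on (Suc k) f S"
proof -
  have "FD f x = D x" if "x \<in> S" for x using FD_eqI assms(2)[OF that] by blast
  hence "Ck_on k (\<lambda>x. FD f x v) S" for v
    by (intro Ck_cong[OF assms(1) assms(3)[of v]]) auto
  thus ?thesis using assms(1,2)
    by (auto simp: differentiable_on_eq_differentiable_at differentiable_def)
qed

lemma Ck_diff: "open S \<Longrightarrow> Ck_on (Suc k) f S \<Longrightarrow> x \<in> S \<Longrightarrow> f differentiable at x"
  by (auto simp: differentiable_on_eq_differentiable_at)

lemma Ck_has: "open S \<Longrightarrow> Ck_on (Suc k) f S \<Longrightarrow> x \<in> S \<Longrightarrow> (f has_derivative FD f x) (at x)"
  using Ck_diff FD_works by blast

lemma Ck_deriv: "Ck_on (Suc k) f S \<Longrightarrow> Ck_on k (\<lambda>x. FD f x v) S"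
  by simp

lemma Ck_cont: "Ck_on k f S \<Longrightarrow> continuous_on S f"
  using differentiable_imp_continuous_on by (cases k) auto

lemma Ck_mono1: "open S \<Longrightarrow> Ck_on (Suc k) f S \<Longrightarrow> Ck_on k f S"
proof (induction k arbitrary: f)
  case 0 thus ?case using Ck_cont[OF 0(2)] by simp
next
  case (Suc k)
  thus ?case by (metis Ck_on.simps(2))
qed

lemma Ck_const: "open S \<Longrightarrow> Ck_on k (\<lambda>x. c) S"
proof (induction k arbitrary: c)
  case (Suc k) thus ?case by (intro Ck_SucI[where D = "\<lambda>_ _. 0"]) auto
qed auto

lemma Ck_subset: "Ck_on k f S \<Longrightarrow> T \<subseteq> S \<Longrightarrow> Ck_on k f T"
proof (induction k arbitrary: f)
  case 0 thus ?case by (auto intro: continuous_on_subset)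
next
  case (Suc k) thus ?case by (auto intro: differentiable_on_subset)
qed

lemma Ck_linear:
  assumes "bounded_linear L"
  shows "open S \<Longrightarrow> Ck_on k f S \<Longrightarrow> Ck_on k (\<lambda>x. L (f x)) S"
proof (induction k arbitrary: f)
  case 0 thus ?case using linear_continuous_on_compose assms
    by (auto intro: bounded_linear.continuous_on)
next
  case (Suc k)
  show ?case
    by (rule Ck_SucI[where D = "\<lambda>x v. L (FD f x v)"])
       (use Suc Ck_has[OF Suc.prems] in \<open>auto intro: bounded_linear.has_derivative[OF assms]\<close>)
qed


lemma Ck_add: "open S \<Longrightarrow> Ck_on k f S \<Longrightarrow> Ck_on k g S \<Longrightarrow> Ck_on k (\<lambda>x. f x + g x) S"
proof (induction k arbitrary: f g)
  case 0 thus ?case by (auto intro: continuous_intros)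
next
  case (Suc k)
  show ?case
    by (rule Ck_SucI[where D = "\<lambda>x v. FD f x v + FD g x v"])
       (use Suc Ck_has[OF Suc.prems(1,2)] Ck_has[OF Suc.prems(1,3)] in \<open>auto intro: has_derivative_add\<close>)
qed

lemma Ck_bilinear:
  assumes "bounded_bilinear B"
  shows "open S \<Longrightarrow> Ck_on k f S \<Longrightarrow> Ck_on k g S \<Longrightarrow> Ck_on k (\<lambda>x. B (f x) (g x)) S"
proof (induction k arbitrary: f g)
  case 0 thus ?case by (auto intro: bounded_bilinear.continuous_on[OF assms])
next
  case (Suc k)
  show ?case
  proof (rule Ck_SucI[where D = "\<lambda>x v. B (f x) (FD g x v) + B (FD f x v) (g x)"])
    show "((\<lambda>x. B (f x) (g x)) has_derivative (\<lambda>v. B (f x) (FD g x v) + B (FD f x v) (g x))) (at x)"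
      if "x \<in> S" for x
      using Suc.prems that by (intro bounded_bilinear.FDERIV[OF assms] Ck_has)
    show "Ck_on k (\<lambda>x. B (f x) (FD g x v) + B (FD f x v) (g x)) S" for v
      using Suc.prems Ck_mono1[OF Suc.prems(1,2)] Ck_mono1[OF Suc.prems(1,3)]
      by (intro Ck_add Suc.IH Ck_deriv) auto
  qed (use Suc.prems in auto)
qed

lemma Ck_mult:
  fixes f g :: "'a::euclidean_space \<Rightarrow> 'b::real_normed_algebra"
  shows "open S \<Longrightarrow> Ck_on k f S \<Longrightarrow> Ck_on k g S \<Longrightarrow> Ck_on k (\<lambda>x. f x * g x) S"
  by (rule Ck_bilinear[OF bounded_bilinear_mult])

text \<open>
  The exponent is generalised in the induction because differentiation lowers it.
\<close>

lemma Ck_powr: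
  fixes f :: "'a::euclidean_space \<Rightarrow> real"
  shows "open S \<Longrightarrow> Ck_on k f S \<Longrightarrow> (\<And>x. x \<in> S \<Longrightarrow> f x > 0) \<Longrightarrow> Ck_on k (\<lambda>x. f x powr a) S"
proof (induction k arbitrary: a)
  case 0
  have "\<forall>x\<in>S. f x \<noteq> 0" using 0(3) by force
  thus ?case using 0(2) by (simp add: continuous_on_powr continuous_on_const)
next
  case (Suc k)
  show ?case
  proof (rule Ck_SucI[where D = "\<lambda>x v. a * f x powr (a - 1) * FD f x v"])
    show "((\<lambda>x. f x powr a) has_derivative (\<lambda>v. a * f x powr (a - 1) * FD f x v)) (at x)"
      if "x \<in> S" for x
    proof -
      have "((\<lambda>u. u powr a) has_real_derivative a * f x powr (a - 1)) (at (f x))"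
        using Suc.prems(3)[OF that] by (rule has_real_derivative_powr)
      hence "((\<lambda>u. u powr a) has_derivative (\<lambda>h. a * f x powr (a - 1) * h)) (at (f x))"
        by (simp add: has_field_derivative_def)
      from has_derivative_compose[OF Ck_has[OF Suc.prems(1,2) that] this] show ?thesis .
    qed
    show "Ck_on k (\<lambda>x. a * f x powr (a - 1) * FD f x v) S" for v
      using Suc.prems Ck_mono1[OF Suc.prems(1,2)]
      by (intro Ck_mult Ck_const Suc.IH Ck_deriv) auto
  qed (use Suc.prems in auto)
qed

text \<open>
  The second difference of \<open>f\<close> over a parallelogram, by the mean value theorem first along \<open>u\<close> and
  then along \<open>v\<close>. As the left-hand side is symmetric in \<open>u\<close> and \<open>v\<close>, so are the second derivatives.
\<close>

lemma mixed_difference: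
  fixes f :: "'a::euclidean_space \<Rightarrow> real"
  assumes C: "Ck_on 2 f S" and S: "open S" and t: "t > 0"
    and sub: "\<And>p q. 0 \<le> p \<Longrightarrow> p \<le> t \<Longrightarrow> 0 \<le> q \<Longrightarrow> q \<le> t \<Longrightarrow> x + p *\<^sub>R u + q *\<^sub>R v \<in> S"
  obtains p q where "0 < p" "p < t" "0 < q" "q < t"
    "f (x + t *\<^sub>R u + t *\<^sub>R v) - f (x + t *\<^sub>R u) - f (x + t *\<^sub>R v) + f x
       = t * t * FD (\<lambda>y. FD f y u) (x + p *\<^sub>R u + q *\<^sub>R v) v"
proof -
  have C2: "Ck_on (Suc (Suc 0)) f S" using C by (simp add: numeral_2_eq_2)
  define \<phi> where "\<phi> s = f (x + s *\<^sub>R u + t *\<^sub>R v) - f (x + s *\<^sub>R u)" for s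
  have along: "((\<lambda>s. h (y + s *\<^sub>R w)) has_real_derivative FD h (y + s *\<^sub>R w) w) (at s)"
    if "h differentiable at (y + s *\<^sub>R w)" for h :: "'a \<Rightarrow> real" and y s w
  proof -
    have "((\<lambda>s. y + s *\<^sub>R w) has_derivative (\<lambda>s. s *\<^sub>R w)) (at s)"
      by (auto intro!: derivative_eq_intros)
    from has_derivative_compose[OF this FD_works[OF that]]
    have "((\<lambda>s. h (y + s *\<^sub>R w)) has_derivative (\<lambda>a. FD h (y + s *\<^sub>R w) (a *\<^sub>R w))) (at s)" .
    moreover have "FD h (y + s *\<^sub>R w) (a *\<^sub>R w) = FD h (y + s *\<^sub>R w) w * a" for a
      using linear_cmul[OF linear_frechet_derivative[OF that]] by simp
    ultimately show ?thesis by (simp add: has_field_derivative_def)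
  qed
  have df: "f differentiable at y" if "y \<in> S" for y using Ck_diff[OF S C2 that] .
  have dfu: "(\<lambda>y. FD f y u) differentiable at y" if "y \<in> S" for y
    using Ck_diff[OF S Ck_deriv[OF C2] that] .
  have sub': "x + p *\<^sub>R u \<in> S" if "0 \<le> p" "p \<le> t" for p using sub[of p 0] that t by simp
  have "\<exists>z. 0 < z \<and> z < t \<and> \<phi> t - \<phi> 0 = (t - 0) * (FD f (x + z *\<^sub>R u + t *\<^sub>R v) u - FD f (x + z *\<^sub>R u) u)"
  proof (rule MVT2[OF t])
    fix s assume s: "0 \<le> s" "s \<le> t"
    have "((\<lambda>s. f ((x + t *\<^sub>R v) + s *\<^sub>R u)) has_real_derivative FD f ((x + t *\<^sub>R v) + s *\<^sub>R u) u) (at s)"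
      using sub[of s t] s t by (intro along df) (auto simp: algebra_simps)
    moreover have "((\<lambda>s. f (x + s *\<^sub>R u)) has_real_derivative FD f (x + s *\<^sub>R u) u) (at s)"
      using sub'[of s] s by (intro along df) auto
    ultimately show "(\<phi> has_real_derivative (FD f (x + s *\<^sub>R u + t *\<^sub>R v) u - FD f (x + s *\<^sub>R u) u)) (at s)"
      unfolding \<phi>_def by (auto intro!: derivative_eq_intros simp: add_ac)
  qed
  then obtain p where p: "0 < p" "p < t"
    "\<phi> t - \<phi> 0 = t * (FD f (x + p *\<^sub>R u + t *\<^sub>R v) u - FD f (x + p *\<^sub>R u) u)" by auto
  have "\<exists>z. 0 < z \<and> z < t \<and> FD f (x + p *\<^sub>R u + t *\<^sub>R v) u - FD f (x + p *\<^sub>R u + 0 *\<^sub>R v) u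
      = (t - 0) * FD (\<lambda>y. FD f y u) (x + p *\<^sub>R u + z *\<^sub>R v) v"
    by (rule MVT2[OF t]) (use p sub in \<open>auto intro!: along dfu\<close>)
  then obtain q where q: "0 < q" "q < t"
    "FD f (x + p *\<^sub>R u + t *\<^sub>R v) u - FD f (x + p *\<^sub>R u) u = t * FD (\<lambda>y. FD f y u) (x + p *\<^sub>R u + q *\<^sub>R v) v"
    by auto
  show thesis
  proof (rule that[OF p(1,2) q(1,2)])
    show "f (x + t *\<^sub>R u + t *\<^sub>R v) - f (x + t *\<^sub>R u) - f (x + t *\<^sub>R v) + f x
       = t * t * FD (\<lambda>y. FD f y u) (x + p *\<^sub>R u + q *\<^sub>R v) v"
      using p(3) q(3) unfolding \<phi>_def by (simp)
  qed
qed

lemma second_derivative_symmetric_real: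
  fixes f :: "'a::euclidean_space \<Rightarrow> real"
  assumes C: "Ck_on 2 f S" and S: "open S" and x: "x \<in> S"
  shows "FD (\<lambda>y. FD f y u) x v = FD (\<lambda>y. FD f y v) x u"
proof (rule ccontr)
  assume ne: "\<not> ?thesis"
  define e where "e = \<bar>FD (\<lambda>y. FD f y u) x v - FD (\<lambda>y. FD f y v) x u\<bar> / 2"
  have e: "e > 0" using ne by (simp add: e_def)
  have C2: "Ck_on (Suc (Suc 0)) f S" using C by (simp add: numeral_2_eq_2)
  have cont: "isCont (\<lambda>y. FD (\<lambda>y. FD f y a) y b) x" for a b
    using Ck_cont[OF Ck_deriv[OF Ck_deriv[OF C2]]] x S continuous_on_eq_continuous_at by blast
  obtain d1 where d1: "d1 > 0" "\<And>y. norm (y - x) < d1 \<Longrightarrow> \<bar>FD (\<lambda>y. FD f y u) y v - FD (\<lambda>y. FD f y u) x v\<bar> < e"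
    using cont[of u v] e unfolding continuous_at_eps_delta dist_norm real_norm_def by meson
  obtain d2 where d2: "d2 > 0" "\<And>y. norm (y - x) < d2 \<Longrightarrow> \<bar>FD (\<lambda>y. FD f y v) y u - FD (\<lambda>y. FD f y v) x u\<bar> < e"
    using cont[of v u] e unfolding continuous_at_eps_delta dist_norm real_norm_def by meson
  obtain d3 where d3: "d3 > 0" "ball x d3 \<subseteq> S" using S x open_contains_ball by blast
  define d where "d = min d1 (min d2 d3)"
  define t where "t = d / (2 * (norm u + norm v + 1))"
  have d: "d > 0" using d1 d2 d3 by (simp add: d_def)
  have nn: "norm u + norm v + 1 > 0" using norm_ge_zero[of u] norm_ge_zero[of v] by linarith
  have t: "t > 0" unfolding t_def using d nn by simp
  have near: "norm (p *\<^sub>R u + q *\<^sub>R v) < d" if "0 \<le> p" "p \<le> t" "0 \<le> q" "q \<le> t" for p q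
  proof -
    have "norm (p *\<^sub>R u + q *\<^sub>R v) \<le> p * norm u + q * norm v"
      using norm_triangle_ineq[of "p *\<^sub>R u" "q *\<^sub>R v"] that by simp
    also have "\<dots> \<le> t * norm u + t * norm v" using that by (intro add_mono mult_right_mono) auto
    also have "\<dots> \<le> t * (norm u + norm v + 1)" using t by (simp add: algebra_simps)
    also have "\<dots> = d / 2" unfolding t_def using nn by (simp add: divide_simps)
    finally show ?thesis using d by simp
  qed
  have sub: "x + p *\<^sub>R u + q *\<^sub>R v \<in> S" "x + q *\<^sub>R v + p *\<^sub>R u \<in> S"
    if "0 \<le> p" "p \<le> t" "0 \<le> q" "q \<le> t" for p q
  proof -
    have "dist (x + (p *\<^sub>R u + q *\<^sub>R v)) x < d3" using near[OF that] unfolding d_def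
      by (simp add: dist_norm)
    hence "x + (p *\<^sub>R u + q *\<^sub>R v) \<in> ball x d3" by (simp add: dist_commute)
    thus "x + p *\<^sub>R u + q *\<^sub>R v \<in> S" "x + q *\<^sub>R v + p *\<^sub>R u \<in> S" using d3(2) by (auto simp: add_ac)
  qed
  obtain p q where pq: "0 < p" "p < t" "0 < q" "q < t"
    "f (x + t *\<^sub>R u + t *\<^sub>R v) - f (x + t *\<^sub>R u) - f (x + t *\<^sub>R v) + f x
       = t * t * FD (\<lambda>y. FD f y u) (x + p *\<^sub>R u + q *\<^sub>R v) v"
    using mixed_difference[OF C S t sub(1)] by blast
  obtain p' q' where pq': "0 < p'" "p' < t" "0 < q'" "q' < t"
    "f (x + t *\<^sub>R v + t *\<^sub>R u) - f (x + t *\<^sub>R v) - f (x + t *\<^sub>R u) + f x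
       = t * t * FD (\<lambda>y. FD f y v) (x + p' *\<^sub>R v + q' *\<^sub>R u) u"
    using mixed_difference[OF C S t sub(2)] by blast
  have "t * t * FD (\<lambda>y. FD f y u) (x + p *\<^sub>R u + q *\<^sub>R v) v = t * t * FD (\<lambda>y. FD f y v) (x + p' *\<^sub>R v + q' *\<^sub>R u) u"
  proof -
    have *: "x + t *\<^sub>R v + t *\<^sub>R u = x + t *\<^sub>R u + t *\<^sub>R v" by simp
    show ?thesis using pq(5) pq'(5) unfolding * by linarith
  qed
  hence eq: "FD (\<lambda>y. FD f y u) (x + p *\<^sub>R u + q *\<^sub>R v) v = FD (\<lambda>y. FD f y v) (x + p' *\<^sub>R v + q' *\<^sub>R u) u"
    using t by simp
  have "\<bar>FD (\<lambda>y. FD f y u) (x + p *\<^sub>R u + q *\<^sub>R v) v - FD (\<lambda>y. FD f y u) x v\<bar> < e"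
    using near[of p q] pq by (intro d1) (auto simp: d_def add_ac)
  moreover have "\<bar>FD (\<lambda>y. FD f y v) (x + p' *\<^sub>R v + q' *\<^sub>R u) u - FD (\<lambda>y. FD f y v) x u\<bar> < e"
    using near[of q' p'] pq' by (intro d2) (auto simp: d_def add_ac)
  ultimately have "\<bar>FD (\<lambda>y. FD f y u) x v - FD (\<lambda>y. FD f y v) x u\<bar> < 2 * e" using eq by linarith
  thus False by (simp add: e_def)
qed

lemma second_derivative_symmetric:
  fixes f :: "'a::euclidean_space \<Rightarrow> 'b::euclidean_space"
  assumes C: "Ck_on 2 f S" and S: "open S" and x: "x \<in> S"
  shows "FD (\<lambda>y. FD f y u) x v = FD (\<lambda>y. FD f y v) x u"
proof (rule euclidean_eqI)
  fix b :: 'b assume "b \<in> Basis"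
  have C2: "Ck_on (Suc (Suc 0)) f S" using C by (simp add: numeral_2_eq_2)
  define F where "F y = f y \<bullet> b" for y
  have CF: "Ck_on 2 F S" unfolding F_def using C S by (intro Ck_linear[OF bounded_linear_inner_left])
  have D1: "FD F y = (\<lambda>w. FD f y w \<bullet> b)" if "y \<in> S" for y
    unfolding F_def by (intro FD_eqI has_derivative_inner_left Ck_has[OF S C2 that])
  have D2: "FD (\<lambda>y. FD F y a) x c = FD (\<lambda>y. FD f y a) x c \<bullet> b" for a c
  proof -
    have "((\<lambda>y. FD f y a \<bullet> b) has_derivative (\<lambda>w. FD (\<lambda>y. FD f y a) x w \<bullet> b)) (at x)"
      by (intro has_derivative_inner_left Ck_has[OF S Ck_deriv[OF C2] x])
    hence "((\<lambda>y. FD F y a) has_derivative (\<lambda>w. FD (\<lambda>y. FD f y a) x w \<bullet> b)) (at x)"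
      using D1 by (auto intro: has_derivative_transform_within_open[OF _ S x])
    thus ?thesis by (simp add: FD_eqI)
  qed
  show "FD (\<lambda>y. FD f y u) x v \<bullet> b = FD (\<lambda>y. FD f y v) x u \<bullet> b"
    using second_derivative_symmetric_real[OF CF S x, of u v] by (simp add: D2)
qed

text \<open>
  The partial derivatives are bounded on the compact ball, hence so is the operator norm of the
  derivative, and the mean value inequality applies because the ball is convex.
\<close>

lemma C1_lipschitz_ball:
  fixes f :: "'a::euclidean_space \<Rightarrow> 'b::real_normed_vector"
  assumes S: "open S" and C: "Ck_on (Suc 0) f S" and sub: "cball x r \<subseteq> S"
  obtains L where "0 \<le> L" "\<And>y z. y \<in> cball x r \<Longrightarrow> z \<in> cball x r \<Longrightarrow> norm (f y - f z) \<le> L * norm (y - z)"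
proof -
  have c: "continuous_on (cball x r) (\<lambda>y. \<Sum>b\<in>Basis. norm (FD f y b))"
    using Ck_cont[OF Ck_deriv[OF C]] sub by (intro continuous_intros) (auto intro: continuous_on_subset)
  have "bounded ((\<lambda>y. \<Sum>b\<in>Basis. norm (FD f y b)) ` cball x r)"
    by (rule compact_imp_bounded[OF compact_continuous_image[OF c compact_cball]])
  then obtain L where LL: "L > 0 \<and>
    (\<forall>w\<in>(\<lambda>y. \<Sum>b\<in>Basis. norm (FD f y b)) ` cball x r. norm w \<le> L)"
    unfolding bounded_pos by (rule exE)
  have L: "L > 0" using LL by (rule conjunct1)
  have Lb: "\<forall>w\<in>(\<lambda>y. \<Sum>b\<in>Basis. norm (FD f y b)) ` cball x r. norm w \<le> L" using LL by (rule conjunct2)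
  have L1: "(\<Sum>b\<in>Basis. norm (FD f y b)) \<le> L" if "y \<in> cball x r" for y
    using bspec[OF Lb imageI[OF that]] by simp
  have on: "onorm (FD f y) \<le> L" if y: "y \<in> cball x r" for y
  proof (rule onorm_bound)
    have lin: "linear (FD f y)" using Ck_diff[OF S C] sub y by (intro linear_frechet_derivative) auto
    fix v
    have "FD f y v = FD f y (\<Sum>b\<in>Basis. (v \<bullet> b) *\<^sub>R b)" by (simp add: euclidean_representation)
    also have "\<dots> = (\<Sum>b\<in>Basis. (v \<bullet> b) *\<^sub>R FD f y b)" using lin by (simp add: linear_sum linear_cmul)
    finally have "norm (FD f y v) = norm (\<Sum>b\<in>Basis. (v \<bullet> b) *\<^sub>R FD f y b)" by (rule arg_cong)
    also have "\<dots> \<le> (\<Sum>b\<in>Basis. norm v * norm (FD f y b))"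
      by (intro sum_norm_le) (auto intro!: mult_right_mono Basis_le_norm)
    also have "\<dots> = (\<Sum>b\<in>Basis. norm (FD f y b)) * norm v" by (simp add: sum_distrib_left mult.commute)
    also have "\<dots> \<le> L * norm v" using L1[OF y] by (intro mult_right_mono) auto
    finally show "norm (FD f y v) \<le> L * norm v" .
  next
    show "0 \<le> L" using L by linarith
  qed
  show thesis
  proof (rule that[of L])
    show "0 \<le> L" using L by linarith
    show "norm (f y - f z) \<le> L * norm (y - z)" if "y \<in> cball x r" "z \<in> cball x r" for y z
    proof (rule differentiable_bound[where S = "cball x r" and f' = "FD f"])
      show "(f has_derivative FD f w) (at w within cball x r)" if w: "w \<in> cball x r" for w
        by (rule has_derivative_at_withinI[OF Ck_has[OF S C subsetD[OF sub w]]])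
      show "convex (cball x r)" by (rule convex_cball)
      show "onorm (FD f w) \<le> L" if "w \<in> cball x r" for w by (rule on[OF that])
      show "y \<in> cball x r" "z \<in> cball x r" by fact+
    qed
  qed
qed

section \<open>Curves on circles\<close>

lemma vector_derivative_const_0:
  assumes "(h has_vector_derivative d) (at t)" "open I" "t \<in> I" "\<And>s. s \<in> I \<Longrightarrow> h s = c"
  shows "d = 0"
proof -
  have "((\<lambda>s. c) has_vector_derivative d) (at t)"
    by (rule has_vector_derivative_transform_within_open[OF assms(1-3)]) (rule assms(4))
  moreover have "((\<lambda>s. c) has_vector_derivative 0) (at t)" by simp
  ultimately show ?thesis using vector_derivative_unique_at by blast
qed

lemma linear_image_derivatives_0:
  fixes x :: "real \<Rightarrow> 'a::euclidean_space"
  assumes L: "bounded_linear L" and I: "open I"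
    and x: "\<And>t. t \<in> I \<Longrightarrow> (x has_vector_derivative x' t) (at t)"
    and z: "\<And>t. t \<in> I \<Longrightarrow> L (x t) = k" and t: "t \<in> I"
  shows "L (x' t) = 0"
  using vector_derivative_const_0[OF bounded_linear.has_vector_derivative[OF L x[OF t]] I t, of k] z
  by simp

text \<open>
  A curve on a line has all its derivatives along the line. On a circle with centre \<open>c\<close>, let
  \<open>q = x - c\<close>. Differentiating \<open>q \<bullet> q = r\<^sup>2\<close> three times gives \<open>q \<bullet> x' = 0\<close>, \<open>q \<bullet> x'' = - x' \<bullet> x'\<close> and
  \<open>q \<bullet> x''' = - 3 x' \<bullet> x''\<close>. Therefore \<open>\<bar>x'\<bar>\<^sup>2 x''' - 3 (x' \<bullet> x'') x''\<close> lies in the plane of the circle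
  and is orthogonal to \<open>q\<close>, as is \<open>x'\<close>: the two are proportional. Proportionality is expressed by a
  common multiple \<open>y\<close>, which also covers \<open>x' t = 0\<close>.
\<close>

lemma circle_jerk:
  fixes x :: "real \<Rightarrow> 'a::euclidean_space"
  assumes S: "round_circle S \<or> straight_line S" and sub: "x ` I \<subseteq> S"
    and I: "open I" and t: "t \<in> I"
    and x1: "\<And>t. t \<in> I \<Longrightarrow> (x has_vector_derivative x' t) (at t)"
    and x2: "\<And>t. t \<in> I \<Longrightarrow> (x' has_vector_derivative x'' t) (at t)"
    and x3: "\<And>t. t \<in> I \<Longrightarrow> (x'' has_vector_derivative x''' t) (at t)"
  shows "\<exists>y k l. (norm (x' t))\<^sup>2 *\<^sub>R x''' t - (3 * (x' t \<bullet> x'' t)) *\<^sub>R x'' t = k *\<^sub>R y \<and> x' t = l *\<^sub>R y"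
proof -
  have planar: "L (x' t) = 0 \<and> L (x'' t) = 0 \<and> L (x''' t) = 0"
    if L: "bounded_linear L" and c: "\<And>y. y \<in> S \<Longrightarrow> L y = k" for L :: "'a \<Rightarrow> 'a" and k
  proof -
    have 1: "L (x' t) = 0" if "t \<in> I" for t
      by (rule linear_image_derivatives_0[OF L I x1 c that]) (use sub in auto)
    have 2: "L (x'' t) = 0" if "t \<in> I" for t by (rule linear_image_derivatives_0[OF L I x2 1 that])
    have 3: "L (x''' t) = 0" if "t \<in> I" for t by (rule linear_image_derivatives_0[OF L I x3 2 that])
    show ?thesis using 1 2 3 t by blast
  qed
  show ?thesis
  proof (cases "straight_line S")
    case True
    then obtain c u where u: "u \<noteq> 0" "S = range (\<lambda>t. c + t *\<^sub>R u)"
      unfolding straight_line_def by blast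
    define L where "L y = y - ((y \<bullet> u) / (u \<bullet> u)) *\<^sub>R u" for y
    have bl: "bounded_linear L" unfolding L_def
      by (intro bounded_linear_intros bounded_linear_sub bounded_linear_scaleR_const
          bounded_linear_compose[OF bounded_linear_divide] bounded_linear_ident bounded_linear_inner_left)
    have k: "L y = L c" if yS: "y \<in> S" for y
    proof -
      obtain s where s: "y = c + s *\<^sub>R u" using yS u(2) by auto
      have "L u = 0" using u(1) by (simp add: L_def)
      thus ?thesis unfolding s using linear_add[OF bounded_linear.linear[OF bl]]
          linear_cmul[OF bounded_linear.linear[OF bl]] by simp
    qed
    have eq: "y = ((y \<bullet> u) / (u \<bullet> u)) *\<^sub>R u" if "L y = 0" for y using that by (simp add: L_def)
    obtain a b c where abc: "x' t = a *\<^sub>R u" "x'' t = b *\<^sub>R u" "x''' t = c *\<^sub>R u"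
      using planar[OF bl k] eq by metis
    have "(norm (x' t))\<^sup>2 *\<^sub>R x''' t - (3 * (x' t \<bullet> x'' t)) *\<^sub>R x'' t
        = ((norm (x' t))\<^sup>2 * c - (3 * (x' t \<bullet> x'' t)) * b) *\<^sub>R u"
      unfolding abc(2,3) by (simp add: scaleR_diff_left)
    thus ?thesis using abc(1) by blast
  next
    case False
    then obtain c u v r where r: "0 < r" "norm u = 1" "norm v = 1" "u \<bullet> v = 0"
      and Sdef: "S = range (\<lambda>t. c + (r * cos t) *\<^sub>R u + (r * sin t) *\<^sub>R v)"
      using S unfolding round_circle_def by blast
    have uu: "u \<bullet> u = 1" "v \<bullet> v = 1" "v \<bullet> u = 0" using r by (simp_all add: norm_eq_1 inner_commute)
    define L where "L y = y - (y \<bullet> u) *\<^sub>R u - (y \<bullet> v) *\<^sub>R v" for y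
    have bl: "bounded_linear L" unfolding L_def
      by (intro bounded_linear_sub bounded_linear_scaleR_const bounded_linear_ident bounded_linear_inner_left)
    have k: "L y = L c" if yS: "y \<in> S" for y
      using yS unfolding Sdef by (auto simp: L_def inner_left_distrib uu r scaleR_add_left algebra_simps)
    have pl: "L (x' t) = 0" "L (x'' t) = 0" "L (x''' t) = 0" using planar[OF bl k] by auto
    define q where "q t = x t - c" for t
    have q1: "(q has_vector_derivative x' s) (at s)" if "s \<in> I" for s
      unfolding q_def using x1[OF that] by (auto intro!: derivative_eq_intros)
    have qq: "q s \<bullet> q s = r\<^sup>2" if "s \<in> I" for s
    proof -
      have "x s \<in> S" using sub that by auto
      then obtain w where w: "x s = c + (r * cos w) *\<^sub>R u + (r * sin w) *\<^sub>R v" unfolding Sdef by auto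
      have "q s = (r * cos w) *\<^sub>R u + (r * sin w) *\<^sub>R v" by (simp add: q_def w)
      hence "q s \<bullet> q s = (r * cos w)\<^sup>2 + (r * sin w)\<^sup>2"
        by (simp add: inner_add_left inner_add_right uu r power2_eq_square)
      also have "\<dots> = r\<^sup>2" using sin_cos_squared_add2[of w] by algebra
      finally show ?thesis .
    qed
    note id = bounded_bilinear.has_vector_derivative[OF bounded_bilinear_inner]
    have e1: "q s \<bullet> x' s = 0" if "s \<in> I" for s
      using vector_derivative_const_0[OF id[OF q1 q1] I that, of "r\<^sup>2"] qq that by (simp add: inner_commute)
    have e2: "q s \<bullet> x'' s + x' s \<bullet> x' s = 0" if "s \<in> I" for s
      using vector_derivative_const_0[OF id[OF q1 x2] I that, of 0] e1 that by simp
    have e3: "q t \<bullet> x''' t + 3 * (x' t \<bullet> x'' t) = 0"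
      using vector_derivative_const_0[OF has_vector_derivative_add[OF id[OF q1 x3] id[OF x2 x2]] I t, of 0] e2 t
      by (simp add: inner_commute)
    have Lq: "L (q t) = 0"
    proof -
      have "x t \<in> S" using sub t by auto
      thus ?thesis unfolding q_def using k linear_diff[OF bounded_linear.linear[OF bl]] by simp
    qed
    define Y where "Y = (norm (x' t))\<^sup>2 *\<^sub>R x''' t - (3 * (x' t \<bullet> x'' t)) *\<^sub>R x'' t"
    have LY: "L Y = 0" unfolding Y_def using pl linear_diff[OF bounded_linear.linear[OF bl]]
        linear_cmul[OF bounded_linear.linear[OF bl]] by simp
    have qY: "q t \<bullet> Y = 0"
      using e2[OF t] e3 unfolding Y_def power2_norm_eq_inner inner_diff_right inner_scaleR_right by algebra
    have rep: "y = (y \<bullet> u) *\<^sub>R u + (y \<bullet> v) *\<^sub>R v" if "L y = 0" for y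
      using that unfolding L_def by (simp add: algebra_simps)
    define q1 q2 where "q1 = q t \<bullet> u" and "q2 = q t \<bullet> v"
    have qrep: "q t = q1 *\<^sub>R u + q2 *\<^sub>R v" using rep[OF Lq] unfolding q1_def q2_def .
    \<comment> \<open>turning the radius by a right angle gives the tangent direction\<close>
    define n where "n = (- q2) *\<^sub>R u + q1 *\<^sub>R v"
    have qr: "q1 * q1 + q2 * q2 = r\<^sup>2"
      using qq[OF t] unfolding qrep by (simp add: inner_add_left inner_add_right uu r)
    have "\<exists>k. y = k *\<^sub>R n" if "L y = 0" "q t \<bullet> y = 0" for y
    proof -
      define a b where "a = y \<bullet> u" and "b = y \<bullet> v"
      have y: "y = a *\<^sub>R u + b *\<^sub>R v" using rep[OF that(1)] unfolding a_def b_def .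
      have o: "q1 * a + q2 * b = 0" using that(2) unfolding qrep inner_add_left by (simp add: a_def b_def inner_commute)
      define k where "k = (q1 * b - q2 * a) / r\<^sup>2"
      have "k * (- q2) = a" "k * q1 = b"
      proof -
        have "(q1 * b - q2 * a) * (- q2) = a * r\<^sup>2" "(q1 * b - q2 * a) * q1 = b * r\<^sup>2"
          using o qr by algebra+
        thus "k * (- q2) = a" "k * q1 = b" using r(1) unfolding k_def by (simp_all add: field_simps)
      qed
      hence "k *\<^sub>R n = y" unfolding n_def y scaleR_add_right scaleR_scaleR by simp
      thus ?thesis by metis
    qed
    then obtain k l where "Y = k *\<^sub>R n" "x' t = l *\<^sub>R n" using LY qY pl(1) e1[OF t] by metis
    thus ?thesis unfolding Y_def by blast
  qed
qed

section \<open>Wirtinger derivatives in two complex variables\<close>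

definition d_hol :: "2 \<Rightarrow> (complex^2 \<Rightarrow> complex) \<Rightarrow> complex^2 \<Rightarrow> complex" where
  "d_hol k f z = (FD f z (axis k 1) - \<i> * FD f z (axis k \<i>)) / 2"
definition d_bar :: "2 \<Rightarrow> (complex^2 \<Rightarrow> complex) \<Rightarrow> complex^2 \<Rightarrow> complex" where
  "d_bar k f z = (FD f z (axis k 1) + \<i> * FD f z (axis k \<i>)) / 2"

lemma FD_wirtinger:
  assumes "f differentiable at z"
  shows "FD f z v = (\<Sum>k\<in>UNIV. d_hol k f z * v $ k + d_bar k f z * cnj (v $ k))"
proof -
  have lin: "linear (FD f z)" using assms by (rule linear_frechet_derivative)
  have v: "v = (\<Sum>k\<in>UNIV. Re (v $ k) *\<^sub>R axis k 1 + Im (v $ k) *\<^sub>R axis k \<i>)"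
    unfolding vec_eq_iff forall_2 by (simp add: sum_2 axis_def complex_eq_iff)
  have "FD f z v = (\<Sum>k\<in>UNIV. Re (v $ k) *\<^sub>R FD f z (axis k 1) + Im (v $ k) *\<^sub>R FD f z (axis k \<i>))"
    by (subst v) (simp add: linear_sum[OF lin] linear_add[OF lin] linear_cmul[OF lin])
  also have "\<dots> = (\<Sum>k\<in>UNIV. d_hol k f z * v $ k + d_bar k f z * cnj (v $ k))"
    by (intro sum.cong refl) (simp add: d_hol_def d_bar_def complex_eq_iff field_simps)
  finally show ?thesis .
qed

lemma wirtinger_cong:
  assumes "open S" "z \<in> S" "\<And>y. y \<in> S \<Longrightarrow> f y = g y"
  shows "d_hol k f z = d_hol k g z" "d_bar k f z = d_bar k g z"
proof -
  have "FD f z = FD g z"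
    unfolding frechet_derivative_def
    by (intro arg_cong[where f = Eps] ext iffI)
       (auto intro: has_derivative_transform_within_open[OF _ assms(1,2)] simp: assms(3))
  thus "d_hol k f z = d_hol k g z" "d_bar k f z = d_bar k g z" by (simp_all add: d_hol_def d_bar_def)
qed

lemma wirtinger_const [simp]: "d_hol k (\<lambda>z. c) z = 0" "d_bar k (\<lambda>z. c) z = 0"
  by (simp_all add: d_hol_def d_bar_def)

lemma wirtinger_add:
  assumes "f differentiable at z" "g differentiable at z"
  shows "d_hol k (\<lambda>z. f z + g z) z = d_hol k f z + d_hol k g z" "d_bar k (\<lambda>z. f z + g z) z = d_bar k f z + d_bar k g z"
  using FD_eqI[OF has_derivative_add[OF assms[THEN FD_works]]]
  by (simp_all add: d_hol_def d_bar_def field_simps)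

lemma wirtinger_diff:
  assumes "f differentiable at z" "g differentiable at z"
  shows "d_hol k (\<lambda>z. f z - g z) z = d_hol k f z - d_hol k g z" "d_bar k (\<lambda>z. f z - g z) z = d_bar k f z - d_bar k g z"
  using FD_eqI[OF has_derivative_diff[OF assms[THEN FD_works]]]
  by (simp_all add: d_hol_def d_bar_def field_simps)

lemma wirtinger_mult:
  assumes "f differentiable at z" "g differentiable at z"
  shows "d_hol k (\<lambda>z. f z * g z) z = d_hol k f z * g z + f z * d_hol k g z"
    and "d_bar k (\<lambda>z. f z * g z) z = d_bar k f z * g z + f z * d_bar k g z"
  using FD_eqI[OF has_derivative_mult[OF assms[THEN FD_works]]]
  by (simp_all add: d_hol_def d_bar_def field_simps)

lemma wirtinger_cnj:
  assumes "f differentiable at z"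
  shows "d_hol k (\<lambda>z. cnj (f z)) z = cnj (d_bar k f z)" "d_bar k (\<lambda>z. cnj (f z)) z = cnj (d_hol k f z)"
  using FD_eqI[OF bounded_linear.has_derivative[OF bounded_linear_cnj FD_works[OF assms]]]
  by (simp_all add: d_hol_def d_bar_def field_simps)

lemma wirtinger_coordinate:
  "(\<lambda>z :: complex^2. z $ m - c) differentiable at z"
  "d_hol k (\<lambda>z. z $ m - c) z = (if k = m then 1 else 0)" "d_bar k (\<lambda>z. z $ m - c) z = 0"
proof -
  have d: "((\<lambda>z :: complex^2. z $ m - c) has_derivative (\<lambda>v. v $ m)) (at z)"
    using bounded_linear_imp_has_derivative[OF bounded_linear_vec_nth] by (auto intro!: derivative_eq_intros)
  thus "(\<lambda>z :: complex^2. z $ m - c) differentiable at z" by (auto simp: differentiable_def)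
  show "d_hol k (\<lambda>z. z $ m - c) z = (if k = m then 1 else 0)" "d_bar k (\<lambda>z. z $ m - c) z = 0"
    by (simp_all add: d_hol_def d_bar_def FD_eqI[OF d] axis_def)
qed

lemma wirtinger_of_real_powr:
  fixes f :: "complex^2 \<Rightarrow> real"
  assumes "f differentiable at z" "f z > 0"
  shows "d_hol k (\<lambda>z. complex_of_real (f z powr a)) z = of_real (a * f z powr (a - 1)) * d_hol k (\<lambda>z. of_real (f z)) z"
proof -
  have "((\<lambda>u. u powr a) has_real_derivative a * f z powr (a - 1)) (at (f z))"
    using assms(2) by (rule has_real_derivative_powr)
  hence "((\<lambda>u. u powr a) has_derivative (\<lambda>h. a * f z powr (a - 1) * h)) (at (f z))"
    by (simp add: has_field_derivative_def)
  from has_derivative_compose[OF FD_works[OF assms(1)] this]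
  have p: "((\<lambda>x. f x powr a) has_derivative (\<lambda>v. a * f z powr (a - 1) * FD f z v)) (at z)" .
  show ?thesis
    unfolding d_hol_def FD_eqI[OF has_derivative_of_real[OF p]] FD_eqI[OF has_derivative_of_real[OF FD_works[OF assms(1)]]]
    by (simp add: field_simps)
qed

lemma bounded_linear_axis: "bounded_linear (axis k :: 'a::euclidean_space \<Rightarrow> 'a ^ 'n)"
  by (auto intro!: linear_conv_bounded_linear[THEN iffD1] linearI simp: vec_eq_iff axis_def)

lemma Ck_wirtinger:
  assumes "open S" "Ck_on (Suc n) f S"
  shows "Ck_on n (d_hol k f) S" "Ck_on n (d_bar k f) S"
proof -
  have 1: "Ck_on n (\<lambda>z. (1/2) * (FD f z (axis k 1) + (- \<i>) * FD f z (axis k \<i>))) S"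
    by (intro Ck_mult Ck_add Ck_const Ck_deriv assms)
  have 2: "Ck_on n (\<lambda>z. (1/2) * (FD f z (axis k 1) + \<i> * FD f z (axis k \<i>))) S"
    by (intro Ck_mult Ck_add Ck_const Ck_deriv assms)
  show "Ck_on n (d_hol k f) S" "Ck_on n (d_bar k f) S"
    by (rule Ck_cong[OF assms(1) 1], simp add: d_hol_def) (rule Ck_cong[OF assms(1) 2], simp add: d_bar_def)
qed

lemma FD_lincomb:
  assumes "f differentiable at z" "g differentiable at z"
  shows "FD (\<lambda>y. (f y + c * g y) / 2) z v = (FD f z v + c * FD g z v) / (2::complex)"
proof -
  have "((\<lambda>y. (f y + c * g y) / 2) has_derivative (\<lambda>v. (FD f z v + c * FD g z v) / 2)) (at z)"
    using assms[THEN FD_works] by (auto intro!: derivative_eq_intros)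
  thus ?thesis by (simp add: FD_eqI)
qed

lemma wirtinger_commute:
  assumes S: "open S" and C: "Ck_on (Suc (Suc 0)) f S" and z: "z \<in> S"
  shows "d_hol k (d_hol m f) z = d_hol m (d_hol k f) z" "d_bar k (d_hol m f) z = d_hol m (d_bar k f) z"
proof -
  have d: "(\<lambda>y. FD f y u) differentiable at z" for u using Ck_diff[OF S Ck_deriv[OF C] z] .
  have sym: "FD (\<lambda>y. FD f y u) z v = FD (\<lambda>y. FD f y v) z u" for u v
    using second_derivative_symmetric[OF _ S z, of f] C by (simp add: numeral_2_eq_2)
  have w: "d_hol m f = (\<lambda>z. (FD f z (axis m 1) + (- \<i>) * FD f z (axis m \<i>)) / 2)"
    "d_bar m f = (\<lambda>z. (FD f z (axis m 1) + \<i> * FD f z (axis m \<i>)) / 2)" for m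
    by (auto simp: d_hol_def d_bar_def fun_eq_iff)
  show "d_hol k (d_hol m f) z = d_hol m (d_hol k f) z" "d_bar k (d_hol m f) z = d_hol m (d_bar k f) z"
    unfolding w unfolding d_hol_def[of _ _ z] d_bar_def[of _ _ z] FD_lincomb[OF d d]
    using sym[of "axis m 1" "axis k 1"] sym[of "axis m \<i>" "axis k 1"] sym[of "axis m 1" "axis k \<i>"]
      sym[of "axis m \<i>" "axis k \<i>"] by (simp_all add: field_simps)
qed

text \<open>
  By \<open>FD_wirtinger\<close> the two kinds of derivative determine the real derivative, which therefore vanishes.
\<close>

lemma constant_if_wirtinger_0:
  assumes S: "open S" "connected S" and C: "Ck_on (Suc 0) f S"
    and 0: "\<And>z k. z \<in> S \<Longrightarrow> d_hol k f z = 0" "\<And>z k. z \<in> S \<Longrightarrow> d_bar k f z = 0"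
  obtains c where "\<And>z. z \<in> S \<Longrightarrow> f z = c"
proof -
  have "(f has_derivative (\<lambda>h. 0)) (at z within S)" if "z \<in> S" for z
  proof -
    have "FD f z = (\<lambda>h. 0)" using FD_wirtinger[OF Ck_diff[OF S(1) C that]] 0[OF that] by auto
    thus ?thesis using has_derivative_at_withinI[OF Ck_has[OF S(1) C that], of S] by simp
  qed
  hence "f constant_on S"
    using has_derivative_zero_connected_constant_on[OF S(2,1) finite.emptyI Ck_cont[OF C], of ] by auto
  thus thesis using that unfolding constant_on_def by blast
qed

section \<open>Kaehler metrics as matrices of Hermitian coefficients\<close>

definition herm_form ::
  "(2 \<Rightarrow> 2 \<Rightarrow> complex^2 \<Rightarrow> complex) \<Rightarrow> complex^2 \<Rightarrow> complex^2 \<Rightarrow> complex^2 \<Rightarrow> complex" where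
  "herm_form H z v w = (\<Sum>i\<in>UNIV. \<Sum>j\<in>UNIV. v $ i * cnj (w $ j) * H i j z)"

text \<open>
  The (1,0)-part of the derivative of \<open>herm_form H z v w\<close> in the direction \<open>u\<close>.
\<close>

definition d_herm_form ::
  "(2 \<Rightarrow> 2 \<Rightarrow> complex^2 \<Rightarrow> complex) \<Rightarrow> complex^2 \<Rightarrow> complex^2 \<Rightarrow> complex^2 \<Rightarrow> complex^2 \<Rightarrow> complex" where
  "d_herm_form H z u v w = (\<Sum>k\<in>UNIV. \<Sum>i\<in>UNIV. \<Sum>j\<in>UNIV. u $ k * v $ i * cnj (w $ j) * d_hol k (H i j) z)"

text \<open>
  The determinant of a Hermitian matrix is real.
\<close>

definition herm_det :: "(2 \<Rightarrow> 2 \<Rightarrow> complex^2 \<Rightarrow> complex) \<Rightarrow> complex^2 \<Rightarrow> real" where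
  "herm_det H z = Re (H 1 1 z * H 2 2 z - H 1 2 z * H 2 1 z)"

text \<open>
  The metric is the real part of a Hermitian form with coefficients \<open>H i j\<close>. The last assumption is the
  Kaehler condition: \<open>d\<omega> = 0\<close> says exactly that \<open>\<partial>\<^sub>k H i j\<close> is symmetric in \<open>k\<close> and \<open>i\<close>.
\<close>

locale kaehler_coefficients =
  fixes H :: "2 \<Rightarrow> 2 \<Rightarrow> complex^2 \<Rightarrow> complex" and \<Omega> :: "(complex^2) set"
  assumes open_dom: "open \<Omega>"
    and smooth: "Ck_on n (H i j) \<Omega>"
    and hermitian: "z \<in> \<Omega> \<Longrightarrow> H j i z = cnj (H i j z)"
    and pos: "z \<in> \<Omega> \<Longrightarrow> v \<noteq> 0 \<Longrightarrow> 0 < Re (herm_form H z v v)"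
    and closed: "z \<in> \<Omega> \<Longrightarrow> d_hol k (H i j) z = d_hol i (H k j) z"

lemma complex2_expand: "v = Re (v$1) *\<^sub>R axis 1 1 + Im (v$1) *\<^sub>R axis 1 \<i> + Re (v$2) *\<^sub>R axis 2 1 + Im (v$2) *\<^sub>R axis (2::2) \<i>"
  unfolding vec_eq_iff forall_2 by (simp add: axis_def complex_eq_iff)

text \<open>
  Hermitian symmetry turns the (0,1)-part of the derivative into the conjugate of the (1,0)-part with
  \<open>v\<close> and \<open>w\<close> exchanged, so that \<open>d_herm_form\<close> carries all first-order information.
\<close>

lemma herm_form_has_derivative:
  assumes d: "\<And>i j. H i j differentiable at z" and "open \<Omega>" "z \<in> \<Omega>"
    and h: "\<And>z i j. z \<in> \<Omega> \<Longrightarrow> H j i z = cnj (H i j z)"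
  shows "((\<lambda>x. herm_form H x v w) has_derivative (\<lambda>u. d_herm_form H z u v w + cnj (d_herm_form H z u w v))) (at z)"
proof -
  have wbH: "d_bar k (H i j) z = cnj (d_hol k (H j i) z)" for k i j
  proof -
    have "d_bar k (H i j) z = d_bar k (\<lambda>z. cnj (H j i z)) z"
      by (rule wirtinger_cong[OF assms(2,3)]) (rule h)
    thus ?thesis using wirtinger_cnj[OF d] by simp
  qed
  have "((\<lambda>x. herm_form H x v w) has_derivative (\<lambda>u. \<Sum>i\<in>UNIV. \<Sum>j\<in>UNIV. v $ i * cnj (w $ j) * FD (H i j) z u)) (at z)"
    unfolding herm_form_def by (intro has_derivative_sum has_derivative_mult_right FD_works d)
  moreover have "(\<Sum>i\<in>UNIV. \<Sum>j\<in>UNIV. v $ i * cnj (w $ j) * FD (H i j) z u)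
      = d_herm_form H z u v w + cnj (d_herm_form H z u w v)" for u
    unfolding FD_wirtinger[OF d] d_herm_form_def wbH by (simp add: sum_2 algebra_simps)
  ultimately show ?thesis by simp
qed

text \<open>
  With \<open>A u v w = \<partial>\<^sub>u h(v,w) - \<partial>\<^sub>v h(u,w)\<close>, the equation \<open>d\<omega> = 0\<close> reads
  \<open>Im (A u v w + A v w u + A w u v) = 0\<close>. Replacing \<open>u, v\<close> by \<open>\<i>u, \<i>v\<close> changes the sign of the first term
  and preserves the other two, because \<open>A\<close> is linear in its first two arguments and conjugate-linear in
  the third. Hence \<open>Im (A u v w) = 0\<close> for all \<open>u\<close>, and \<open>u \<mapsto> \<i>u\<close> then gives \<open>A = 0\<close>.
\<close>

lemma kaehler_metric_coefficients:
  assumes O: "open \<Omega>" and K: "kaehler_metric \<Omega> g"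
  obtains H where "kaehler_coefficients H \<Omega>" "\<And>z v w. z \<in> \<Omega> \<Longrightarrow> g z v w = Re (herm_form H z v w)"
proof -
  have R: "\<forall>v w. smooth_on (\<lambda>z. g z v w) \<Omega>"
    and bil: "\<And>z. z \<in> \<Omega> \<Longrightarrow> bilinear (g z)"
    and sym: "\<And>z v w. z \<in> \<Omega> \<Longrightarrow> g z v w = g z w v"
    and pos: "\<And>z v. z \<in> \<Omega> \<Longrightarrow> v \<noteq> 0 \<Longrightarrow> g z v v > 0"
    and inv: "\<And>z v w. z \<in> \<Omega> \<Longrightarrow> g z (\<i> *s v) (\<i> *s w) = g z v w"
    and closed: "\<And>z u v w. z \<in> \<Omega> \<Longrightarrow> ext_deriv2 (fundamental_form g) z u v w = 0"
    using K unfolding kaehler_metric_def hermitian_metric_def riemannian_metric_def by auto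
  define H where "H i j z = Complex (g z (axis i 1) (axis j 1)) (- g z (axis i \<i>) (axis j 1))"
    for i j :: 2 and z
  have ii: "\<i> *s axis k (1::complex) = axis k \<i>" "\<i> *s axis k \<i> = - axis k 1" for k :: 2
    by (simp_all add: vec_eq_iff axis_def)
  have rel: "g z (axis i \<i>) (axis j \<i>) = g z (axis i 1) (axis j 1)"
      "g z (axis i 1) (axis j \<i>) = - g z (axis i \<i>) (axis j 1)" if z: "z \<in> \<Omega>" for i j z
    using inv[OF z, of "axis i 1" "axis j 1"] inv[OF z, of "axis i 1" "axis j \<i>"] bilinear_rneg[OF bil[OF z]]
    by (simp_all add: ii)
  have gH: "g z v w = Re (herm_form H z v w)" if z: "z \<in> \<Omega>" for z v w
  proof -
    note b = bilinear_ladd[OF bil[OF z]] bilinear_radd[OF bil[OF z]] bilinear_lmul[OF bil[OF z]] bilinear_rmul[OF bil[OF z]]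
    show ?thesis
      apply (subst complex2_expand[of v], subst complex2_expand[of w])
      apply (simp only: b rel[OF z])
      apply (simp add: herm_form_def H_def sum_2 algebra_simps)
      done
  qed
  have herm_form: "H j i z = cnj (H i j z)" if z: "z \<in> \<Omega>" for z i j
    using sym[OF z, of "axis j 1" "axis i 1"] rel(2)[OF z, of i j] sym[OF z, of "axis j \<i>" "axis i 1"]
    by (simp add: H_def complex_eq_iff)
  have Hsm: "Ck_on n (H i j) \<Omega>" for n i j
  proof -
    have "Ck_on n (\<lambda>z. complex_of_real (g z (axis i 1) (axis j 1)) + (- \<i>) * complex_of_real (g z (axis i \<i>) (axis j 1))) \<Omega>"
      using R unfolding smooth_on_def
      by (intro Ck_add Ck_mult Ck_const O Ck_linear[OF bounded_linear_of_real]) auto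
    thus ?thesis by (rule Ck_cong[OF O]) (simp add: H_def complex_eq_iff)
  qed
  have Hd: "H i j differentiable at z" if "z \<in> \<Omega>" for i j z using Ck_diff[OF O Hsm that] .
  define A where "A z u v w = d_herm_form H z u v w - d_herm_form H z v u w" for z u v w
  have dw: "dir_deriv (\<lambda>x. fundamental_form g x v w) z u = - Im (d_herm_form H z u v w) + Im (d_herm_form H z u w v)"
    if z: "z \<in> \<Omega>" for z u v w
  proof -
    have a: "((\<lambda>x. - Im (herm_form H x v w)) has_derivative (\<lambda>u. - Im (d_herm_form H z u v w + cnj (d_herm_form H z u w v)))) (at z)"
      by (intro has_derivative_minus bounded_linear.has_derivative[OF bounded_linear_Im]
          herm_form_has_derivative[OF Hd[OF z] O z herm_form])
    have b: "- Im (herm_form H x v w) = fundamental_form g x v w" if "x \<in> \<Omega>" for x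
      unfolding fundamental_form_def gH[OF that] by (simp add: herm_form_def sum_2 algebra_simps)
    have "((\<lambda>x. fundamental_form g x v w) has_derivative (\<lambda>u. - Im (d_herm_form H z u v w + cnj (d_herm_form H z u w v)))) (at z)"
      by (rule has_derivative_transform_within_open[OF a O z b])
    thus ?thesis by (simp add: dir_deriv_def FD_eqI)
  qed
  have A0: "Im (A z u v w + A z v w u + A z w u v) = 0" if z: "z \<in> \<Omega>" for z u v w
    using closed[OF z, of u v w] unfolding ext_deriv2_def dw[OF z] A_def by simp
  have "A z u v w = 0" if z: "z \<in> \<Omega>" for z u v w
  proof -
    have i: "A z (\<i> *s u) (\<i> *s v) w = - A z u v w" "A z (\<i> *s v) w (\<i> *s u) = A z v w u"
      "A z w (\<i> *s u) (\<i> *s v) = A z w u v" "A z (\<i> *s u) v w = \<i> * A z u v w" for u v w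
      unfolding A_def d_herm_form_def by (simp_all add: sum_2 algebra_simps)
    have "Im (A z u v w) = 0" for u
      using A0[OF z, of u v w] A0[OF z, of "\<i> *s u" "\<i> *s v" w, unfolded i(1-3)] by simp
    from this[of u] this[of "\<i> *s u"] show ?thesis unfolding i(4) by (simp add: complex_eq_iff)
  qed
  hence dsym: "d_herm_form H z u v w = d_herm_form H z v u w" if "z \<in> \<Omega>" for z u v w
    using that unfolding A_def right_minus_eq by blast
  have basis: "d_herm_form H z (axis k 1) (axis i 1) (axis j 1) = d_hol k (H i j) z" for z k i j
    unfolding d_herm_form_def using exhaust_2[of k] exhaust_2[of i] exhaust_2[of j] by (auto simp: sum_2 axis_def)
  have cl: "d_hol k (H i j) z = d_hol i (H k j) z" if "z \<in> \<Omega>" for z k i j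
    using dsym[OF that, of "axis k 1" "axis i 1" "axis j 1"] unfolding basis .
  have "kaehler_coefficients H \<Omega>"
  proof
    show "0 < Re (herm_form H z v v)" if "z \<in> \<Omega>" "v \<noteq> 0" for z v using pos[OF that] gH[OF that(1)] by simp
  qed (fact O Hsm herm_form cl)+
  thus thesis using that gH by blast
qed

context kaehler_coefficients
begin

lemma diff: "z \<in> \<Omega> \<Longrightarrow> H i j differentiable at z"
  using Ck_diff[OF open_dom smooth] .

lemma diag_real: "z \<in> \<Omega> \<Longrightarrow> H i i z = of_real (Re (H i i z))"
  using hermitian[of z i i] by (simp add: complex_eq_iff)

lemma herm_det_of_real: "z \<in> \<Omega> \<Longrightarrow> of_real (herm_det H z) = H 1 1 z * H 2 2 z - H 1 2 z * H 2 1 z"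
  using hermitian[of z 1 2] hermitian[of z 1 1] hermitian[of z 2 2]
  by (simp add: herm_det_def complex_eq_iff)

lemma H11_pos: assumes z: "z \<in> \<Omega>" shows "0 < Re (H 1 1 z)"
proof -
  have "axis 1 1 \<noteq> (0 :: complex^2)" by (simp add: axis_eq_0_iff)
  from pos[OF z this] show ?thesis by (simp add: herm_form_def sum_2 axis_def)
qed

text \<open>
  The vector \<open>v = (- H 2 1, H 1 1)\<close> is orthogonal to the first basis vector, and its squared length is
  \<open>H 1 1\<close> times the determinant.
\<close>

lemma herm_det_pos: assumes z: "z \<in> \<Omega>" shows "0 < herm_det H z"
proof -
  define v :: "complex^2" where "v = vector [- H 2 1 z, H 1 1 z]"
  have "v \<noteq> 0" using H11_pos[OF z] by (auto simp: v_def vec_eq_iff forall_2)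
  hence "0 < Re (herm_form H z v v)" using pos[OF z] by blast
  also have "herm_form H z v v = H 1 1 z * (H 1 1 z * H 2 2 z - H 1 2 z * H 2 1 z)"
    using hermitian[OF z, of 1 1] hermitian[OF z, of 2 1]
    by (simp add: herm_form_def sum_2 v_def algebra_simps)
  also have "\<dots> = of_real (Re (H 1 1 z)) * of_real (herm_det H z)"
    using diag_real[OF z, of 1] herm_det_of_real[OF z] by simp
  finally show ?thesis using H11_pos[OF z] by (simp add: zero_less_mult_iff)
qed

lemma herm_det_smooth: "Ck_on n (herm_det H) \<Omega>"
proof -
  have "Ck_on n (\<lambda>z. Re (H 1 1 z * H 2 2 z + (-1) * (H 1 2 z * H 2 1 z))) \<Omega>"
    by (intro Ck_linear[OF bounded_linear_Re] Ck_add Ck_mult Ck_const smooth open_dom)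
  thus ?thesis by (rule Ck_cong[OF open_dom]) (simp add: herm_det_def)
qed

text \<open>
  Cramer's rule for the linear system of \<open>chr_coeff_solves\<close>. The reciprocal of the determinant is written
  as a real power so that \<open>Ck_powr\<close> yields smoothness.
\<close>

definition chr_coeff :: "2 \<Rightarrow> 2 \<Rightarrow> 2 \<Rightarrow> complex^2 \<Rightarrow> complex" where
  "chr_coeff m k i z = of_real (herm_det H z powr (-1)) *
     (if m = 1 then d_hol k (H i 1) z * H 2 2 z - d_hol k (H i 2) z * H 2 1 z
      else d_hol k (H i 2) z * H 1 1 z - d_hol k (H i 1) z * H 1 2 z)"

text \<open>
  The acceleration of a geodesic, a complex quadratic map of the velocity. That it involves no
  conjugates is where the Kaehler condition enters the argument.
\<close>

definition geod_acc :: "complex^2 \<Rightarrow> complex^2 \<Rightarrow> complex^2" where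
  "geod_acc z v = (\<chi> m. - (\<Sum>k\<in>UNIV. \<Sum>i\<in>UNIV. chr_coeff m k i z * (v $ k * v $ i)))"

lemma chr_coeff_solves:
  assumes z: "z \<in> \<Omega>"
  shows "d_hol k (H i j) z = (\<Sum>m\<in>UNIV. chr_coeff m k i z * H m j z)"
proof -
  have d: "complex_of_real (herm_det H z powr (-1)) * (H 1 1 z * H 2 2 z - H 1 2 z * H 2 1 z) = 1"
    unfolding herm_det_of_real[OF z, symmetric] using herm_det_pos[OF z] by (simp add: powr_minus field_simps)
  show ?thesis
  proof (cases "j = 1")
    case True
    have "(\<Sum>m\<in>UNIV. chr_coeff m k i z * H m 1 z) = (complex_of_real (herm_det H z powr (-1)) * (H 1 1 z * H 2 2 z - H 1 2 z * H 2 1 z)) * d_hol k (H i 1) z"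
      unfolding sum_2 chr_coeff_def by (simp add: algebra_simps)
    thus ?thesis unfolding d True by simp
  next
    case False
    hence j: "j = 2" using exhaust_2 by blast
    have "(\<Sum>m\<in>UNIV. chr_coeff m k i z * H m 2 z) = (complex_of_real (herm_det H z powr (-1)) * (H 1 1 z * H 2 2 z - H 1 2 z * H 2 1 z)) * d_hol k (H i 2) z"
      unfolding sum_2 chr_coeff_def by (simp add: algebra_simps)
    thus ?thesis unfolding d j by simp
  qed
qed

lemma chr_coeff_smooth: "Ck_on n (chr_coeff m k i) \<Omega>"
proof -
  have d: "Ck_on n (\<lambda>z. complex_of_real (herm_det H z powr (-1))) \<Omega>"
    by (intro Ck_linear[OF bounded_linear_of_real] Ck_powr open_dom herm_det_pos herm_det_smooth)
  note W = Ck_wirtinger(1)[OF open_dom smooth]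
  have "Ck_on n (\<lambda>z. complex_of_real (herm_det H z powr (-1)) *
       (d_hol k (H i 1) z * H 2 2 z + (-1) * (d_hol k (H i 2) z * H 2 1 z))) \<Omega>"
    "Ck_on n (\<lambda>z. complex_of_real (herm_det H z powr (-1)) *
       (d_hol k (H i 2) z * H 1 1 z + (-1) * (d_hol k (H i 1) z * H 1 2 z))) \<Omega>"
    by (intro d Ck_add Ck_mult Ck_const smooth open_dom W)+
  thus ?thesis
    by (cases "m = 1") (auto intro: Ck_cong[OF open_dom] simp: chr_coeff_def)
qed

text \<open>
  Since \<open>dir_deriv\<close> of the metric is \<open>Re (d_herm_form u v w + d_herm_form u w v)\<close>, the symmetry of
  \<open>d_herm_form\<close> in its first two arguments collapses the Koszul formula to \<open>Re (d_herm_form v v w)\<close>,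
  which is the metric product of \<open>- geod_acc z v\<close> with \<open>w\<close> by the choice of \<open>chr_coeff\<close>.
\<close>

lemma koszul:
  assumes z: "z \<in> \<Omega>" and g: "\<And>x v w. x \<in> \<Omega> \<Longrightarrow> g x v w = Re (herm_form H x v w)"
  shows "christoffel g z v v = - geod_acc z v"
proof -
  have D: "dir_deriv (\<lambda>x. g x v w) z u = Re (d_herm_form H z u v w) + Re (d_herm_form H z u w v)" for u v w
  proof -
    have "((\<lambda>x. Re (herm_form H x v w)) has_derivative (\<lambda>u. Re (d_herm_form H z u v w + cnj (d_herm_form H z u w v)))) (at z)"
      by (intro bounded_linear.has_derivative[OF bounded_linear_Re]
          herm_form_has_derivative[OF diff[OF z] open_dom z hermitian])
    hence "((\<lambda>x. g x v w) has_derivative (\<lambda>u. Re (d_herm_form H z u v w + cnj (d_herm_form H z u w v)))) (at z)"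
      by (rule has_derivative_transform_within_open[OF _ open_dom z]) (simp add: g)
    thus ?thesis by (simp add: dir_deriv_def FD_eqI)
  qed
  have s: "d_herm_form H z u v w = d_herm_form H z v u w" for u v w
    unfolding d_herm_form_def using closed[OF z, of 1 2 1] closed[OF z, of 1 2 2] by (simp add: sum_2 algebra_simps)
  have a: "herm_form H z (- geod_acc z v) w = d_herm_form H z v v w" for w
    unfolding herm_form_def d_herm_form_def geod_acc_def chr_coeff_solves[OF z]
    by (simp add: sum_2 algebra_simps)
  have swap: "d_herm_form H z w v v = d_herm_form H z v w v" for w by (rule s)
  have P: "(\<forall>w. g z a w = (dir_deriv (\<lambda>x. g x v w) z v + dir_deriv (\<lambda>x. g x v w) z v - dir_deriv (\<lambda>x. g x v v) z w) / 2)
     \<longleftrightarrow> (\<forall>w. Re (herm_form H z a w) = Re (d_herm_form H z v v w))" for a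
    unfolding D g[OF z] swap by simp
  show ?thesis unfolding christoffel_def P
  proof (rule the_equality)
    show "\<forall>w. Re (herm_form H z (- geod_acc z v) w) = Re (d_herm_form H z v v w)" using a by simp
    fix b assume b: "\<forall>w. Re (herm_form H z b w) = Re (d_herm_form H z v v w)"
    have "herm_form H z (b - (- geod_acc z v)) w = herm_form H z b w - herm_form H z (- geod_acc z v) w" for w
      unfolding herm_form_def by (simp add: sum_2 algebra_simps)
    hence "Re (herm_form H z (b - (- geod_acc z v)) w) = 0" for w using a b by simp
    thus "b = - geod_acc z v" using pos[OF z, of "b - (- geod_acc z v)"] by (metis eq_iff_diff_eq_0 less_irrefl)
  qed
qed

end

section \<open>The circle condition as a polynomial identity\<close>

text \<open>
  Complex conjugation is not complex differentiable: if \<open>q s \<noteq> 0\<close>, then \<open>cnj = - p / q\<close> would be, near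
  \<open>s\<close>. Concretely, the derivative of the vanishing function in the directions \<open>1\<close> and \<open>\<i>\<close> gives two
  equations with difference \<open>2 * q s = 0\<close>.
\<close>

lemma cnj_independent:
  fixes p q :: "complex \<Rightarrow> complex"
  assumes "p field_differentiable (at s)" "q field_differentiable (at s)"
    and eq: "\<And>s. p s + cnj s * q s = 0"
  shows "p s = 0" "q s = 0"
proof -
  obtain p' q' where d: "(p has_field_derivative p') (at s)" "(q has_field_derivative q') (at s)"
    using assms unfolding field_differentiable_def by blast
  have "((\<lambda>s. p s + cnj s * q s) has_derivative (\<lambda>h. p' * h + (cnj s * (q' * h) + cnj h * q s))) (at s)"
    using d unfolding has_field_derivative_def
    by (intro has_derivative_add has_derivative_mult bounded_linear_imp_has_derivative bounded_linear_cnj)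
  moreover have "((\<lambda>s. p s + cnj s * q s) has_derivative (\<lambda>h. 0)) (at s)" unfolding eq by simp
  ultimately have "(\<lambda>h. p' * h + (cnj s * (q' * h) + cnj h * q s)) = (\<lambda>h. 0)"
    by (rule has_derivative_unique)
  from fun_cong[OF this, of 1] fun_cong[OF this, of \<i>]
  have h: "p' + cnj s * q' + q s = 0" "\<i> * (p' + cnj s * q' - q s) = 0" by (simp_all add: algebra_simps)
  hence "p' + cnj s * q' = q s" by simp
  hence "2 * q s = 0" using h(1) by simp
  thus "q s = 0" by simp
  thus "p s = 0" using eq[of s] by simp
qed

lemma cubic_zero:
  fixes c0 c1 c2 c3 :: complex
  assumes "\<And>s. c0 + c1 * s + c2 * s\<^sup>2 + c3 * s ^ 3 = 0"
  shows "c0 = 0" "c1 = 0" "c2 = 0" "c3 = 0"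
proof -
  show 0: "c0 = 0" using assms[of 0] by simp
  have 1: "c1 + c2 + c3 = 0" using assms[of 1] 0 by simp
  have 2: "- c1 + c2 - c3 = 0" using assms[of "-1"] 0 by simp
  have 3: "2 * c1 + 4 * c2 + 8 * c3 = 0" using assms[of 2] 0 by (simp add: mult.commute)
  have "2 * c2 = (c1 + c2 + c3) + (- c1 + c2 - c3)" by simp
  thus c2: "c2 = 0" unfolding 1 2 by simp
  have c1: "c1 = - c3" using 1 c2 by (simp add: eq_neg_iff_add_eq_0)
  have "6 * c3 = 0" using 3 unfolding c1 c2 by simp
  thus c3: "c3 = 0" by simp
  show "c1 = 0" using 1 c2 c3 by simp
qed

text \<open>
  Here \<open>A v\<close> is the acceleration and \<open>J v\<close> the third derivative of a geodesic with velocity \<open>v\<close>; the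
  numbers \<open>p\<close> and \<open>q\<close> are the first derivatives of the connection coefficients. \<open>A\<close> is homogeneous
  quadratic in \<open>v\<close>, while \<open>J = C + E\<close> with \<open>C\<close> cubic in \<open>v\<close> and \<open>E\<close> quadratic in \<open>v\<close> and linear in
  \<open>cnj v\<close>. Under \<open>v \<mapsto> \<i> v\<close> these parts are multiplied by different powers of \<open>\<i>\<close>, so the conditions at
  \<open>v\<close> and at \<open>\<i> v\<close> together remove \<open>E\<close> and leave
  \<open>2 \<bar>v\<bar>\<^sup>2 det (v, C v) = 3 \<langle>A v, v\<rangle> det (v, A v)\<close>.
  For \<open>v = (1, s)\<close> this is a polynomial identity in \<open>s\<close> and \<open>cnj s\<close>, of degree one in \<open>cnj s\<close>.
  Its two coefficients vanish separately by \<open>cnj_independent\<close>; eliminating \<open>C\<close> from them leaves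
  \<open>det (v, A v)\<^sup>2 = 0\<close>. So \<open>A v\<close> is a complex multiple of \<open>v\<close>, which is what the four equations say.
\<close>

lemma jerk_condition_algebra:
  fixes G :: "2 \<Rightarrow> 2 \<Rightarrow> 2 \<Rightarrow> complex" and p q :: "2 \<Rightarrow> 2 \<Rightarrow> 2 \<Rightarrow> 2 \<Rightarrow> complex"
  defines "A \<equiv> \<lambda>(v::complex^2) m. - (\<Sum>k\<in>UNIV. \<Sum>i\<in>UNIV. G m k i * (v $ k * v $ i))"
  defines "J \<equiv> \<lambda>(v::complex^2) m. - (\<Sum>k\<in>UNIV. \<Sum>i\<in>UNIV.
      (\<Sum>l\<in>UNIV. p m k i l * v $ l + q m k i l * cnj (v $ l)) * (v $ k * v $ i)
        + G m k i * (A v k * v $ i + v $ k * A v i))"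
  assumes cond: "\<And>v. v \<noteq> 0 \<Longrightarrow> of_real ((norm v)\<^sup>2) * (v $ 1 * J v 2 - v $ 2 * J v 1)
      = 3 * of_real (Re (\<Sum>k\<in>UNIV. v $ k * cnj (A v k))) * (v $ 1 * A v 2 - v $ 2 * A v 1)"
  shows "G 2 1 1 = 0" "G 1 2 2 = 0" "G 1 1 1 = G 2 1 2 + G 2 2 1" "G 2 2 2 = G 1 1 2 + G 1 2 1"
proof -
  define e where "e s = (vector [1, s] :: complex^2)" for s
  have ene: "e s \<noteq> 0" for s by (auto simp: e_def vec_eq_iff forall_2)
  define \<alpha> where "\<alpha> m s = - (G m 1 1 + (G m 1 2 + G m 2 1) * s + G m 2 2 * s\<^sup>2)" for m s
  define V where "V k s = (if k = 1 then 1 else s)" for k :: 2 and s :: complex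
  define C where "C m s = - (\<Sum>k\<in>UNIV. \<Sum>i\<in>UNIV. (\<Sum>l\<in>UNIV. p m k i l * V l s) * (V k s * V i s)
      + G m k i * (\<alpha> k s * V i s + V k s * \<alpha> i s))" for m s
  define E where "E m s = - (\<Sum>k\<in>UNIV. \<Sum>i\<in>UNIV. (\<Sum>l\<in>UNIV. q m k i l * cnj (V l s)) * (V k s * V i s))" for m s
  have Ve: "e s $ k = V k s" for k s using exhaust_2[of k] by (auto simp: e_def V_def)
  have A1: "A (e s) m = \<alpha> m s" for s m
    unfolding A_def \<alpha>_def Ve by (simp add: sum_2 V_def power2_eq_square algebra_simps)
  have A2: "A (\<i> *s e s) m = - \<alpha> m s" for s m
    unfolding A1[symmetric] unfolding A_def by (simp add: sum_2 algebra_simps)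
  have J1: "J (e s) m = C m s + E m s" for s m
    unfolding J_def C_def E_def A1 Ve
    by (simp add: sum_negf[symmetric] sum.distrib[symmetric] algebra_simps sum_distrib_left sum_distrib_right)
  have J2: "J (\<i> *s e s) m = \<i> * (E m s - C m s)" for s m
    unfolding J_def C_def E_def A2 Ve vector_smult_component
    by (simp add: sum_2 algebra_simps)
  have n1: "complex_of_real ((norm (e s))\<^sup>2) = 1 + s * cnj s" for s
    by (simp add: norm_vec_def L2_set_def sum_2 e_def complex_norm_square[symmetric] )
  have n2: "norm (\<i> *s e s) = norm (e s)" for s
    by (simp add: norm_vec_def norm_mult)
  define \<beta> where "\<beta> s = \<alpha> 1 s + cnj s * \<alpha> 2 s" for s
  have r1: "Re (\<Sum>k\<in>UNIV. e s $ k * cnj (A (e s) k)) = Re (\<beta> s)" for s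
    unfolding A1 Ve \<beta>_def by (simp add: sum_2 V_def)
  have r2: "Re (\<Sum>k\<in>UNIV. (\<i> *s e s) $ k * cnj (A (\<i> *s e s) k)) = - Im (\<beta> s)" for s
    unfolding A2 vector_smult_component Ve \<beta>_def by (simp add: sum_2 V_def algebra_simps)
  (* P s = det (v, C v), d s = det (v, A v) and \<beta> s = \<langle>A v, v\<rangle> for v = (1, s). *)
  define P where "P s = C 2 s - s * C 1 s" for s
  define d where "d s = \<alpha> 2 s - s * \<alpha> 1 s" for s
  have key: "2 * (1 + s * cnj s) * P s = 3 * \<beta> s * d s" for s
  proof -
    let ?n = "1 + s * cnj s"
    have v12: "V 1 s = 1" "V 2 s = s" by (simp_all add: V_def)
    have c1: "?n * (P s + (E 2 s - s * E 1 s)) = 3 * of_real (Re (\<beta> s)) * d s"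
      using cond[OF ene[of s]] unfolding n1 r1 unfolding J1 A1 Ve v12 P_def d_def by (simp add: algebra_simps)
    have ie: "\<i> *s e s \<noteq> 0" using ene by simp
    have c2: "?n * (P s - (E 2 s - s * E 1 s)) = 3 * (\<i> * of_real (Im (\<beta> s))) * d s"
    proof -
      have "?n * (\<i> * (\<i> * (E 2 s - C 2 s)) - \<i> * s * (\<i> * (E 1 s - C 1 s)))
          = 3 * of_real (- Im (\<beta> s)) * (\<i> * (- \<alpha> 2 s) - \<i> * s * (- \<alpha> 1 s))"
        using cond[OF ie] unfolding n2 n1 r2 unfolding J2 A2 vector_smult_component Ve v12 by simp
      thus ?thesis unfolding P_def d_def by (simp add: algebra_simps)
    qed
    have "2 * ?n * P s = ?n * (P s + (E 2 s - s * E 1 s)) + ?n * (P s - (E 2 s - s * E 1 s))"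
      by (simp add: algebra_simps)
    also have "\<dots> = 3 * (of_real (Re (\<beta> s)) + \<i> * of_real (Im (\<beta> s))) * d s"
      unfolding c1 c2 by (simp add: algebra_simps)
    finally show ?thesis using complex_eq[of "\<beta> s"] by simp
  qed
  have \<alpha>d: "\<alpha> m field_differentiable (at s)" for m s
    unfolding \<alpha>_def[abs_def] by (intro derivative_intros)
  have Vd: "V m field_differentiable (at s)" for m s
  proof (cases "m = 1")
    case True
    hence "V m = (\<lambda>s. 1)" by (simp add: V_def fun_eq_iff)
    thus ?thesis by simp
  next
    case False
    hence "V m = (\<lambda>s. s)" by (simp add: V_def fun_eq_iff)
    thus ?thesis by simp
  qed
  have Cd: "C m field_differentiable (at s)" for m s
    unfolding C_def[abs_def]
    by (intro derivative_intros field_differentiable_sum field_differentiable_mult field_differentiable_add \<alpha>d Vd)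
  have dd: "d field_differentiable (at s)" for s
    unfolding d_def[abs_def] by (intro derivative_intros field_differentiable_mult \<alpha>d)
  have Pd: "P field_differentiable (at s)" for s
    unfolding P_def[abs_def] by (intro derivative_intros field_differentiable_mult Cd)
  (* The coefficients of 1 and of cnj s in the identity key. *)
  define pp where "pp s = 2 * P s - 3 * \<alpha> 1 s * d s" for s
  define qq where "qq s = 2 * (s * P s) - 3 * \<alpha> 2 s * d s" for s
  have "pp field_differentiable (at s)" for s
    unfolding pp_def[abs_def] by (intro derivative_intros field_differentiable_mult Pd \<alpha>d dd)
  moreover have "qq field_differentiable (at s)" for s
    unfolding qq_def[abs_def] by (intro derivative_intros field_differentiable_mult Pd \<alpha>d dd)
  moreover have "pp s + cnj s * qq s = 0" for s
    using key[of s] unfolding pp_def qq_def \<beta>_def by (simp add: algebra_simps)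
  ultimately have pq: "pp s = 0" "qq s = 0" for s using cnj_independent by blast+
  have "d s = 0" for s
  proof -
    have "3 * (d s * d s) = s * pp s - qq s" unfolding pp_def qq_def d_def by (simp add: algebra_simps)
    thus ?thesis using pq by simp
  qed
  hence "G 2 1 1 + (G 2 1 2 + G 2 2 1 - G 1 1 1) * s + (G 2 2 2 - G 1 1 2 - G 1 2 1) * s\<^sup>2 + (- G 1 2 2) * s ^ 3 = 0" for s
    unfolding d_def \<alpha>_def by (simp add: algebra_simps power2_eq_square power3_eq_cube eq_neg_iff_add_eq_0)
  from cubic_zero[OF this]
  show "G 2 1 1 = 0" "G 1 2 2 = 0" "G 1 1 1 = G 2 1 2 + G 2 2 1" "G 2 2 2 = G 1 1 2 + G 1 2 1"
    by (simp_all add: algebra_simps)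
qed

section \<open>Geodesics\<close>

lemma Ck_compose_linear:
  fixes L :: "'c::euclidean_space \<Rightarrow> 'a::euclidean_space"
  assumes L: "bounded_linear L" and S: "open S"
  shows "Ck_on k f S \<Longrightarrow> Ck_on k (\<lambda>p. f (L p)) (L -` S)"
proof (induction k arbitrary: f)
  case 0
  thus ?case using continuous_on_compose2[OF _ linear_continuous_on[OF L], of S f "L -` S"] by auto
next
  case (Suc k)
  have o: "open (L -` S)" using L S by (simp add: bounded_linear.continuous_on open_vimage linear_continuous_on)
  show ?case
  proof (rule Ck_SucI[where D = "\<lambda>p v. FD f (L p) (L v)", OF o])
    show "((\<lambda>p. f (L p)) has_derivative (\<lambda>v. FD f (L p) (L v))) (at p)" if "p \<in> L -` S" for p
      by (rule has_derivative_compose[OF bounded_linear_imp_has_derivative[OF L] Ck_has[OF S Suc.prems]]) (use that in auto)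
    show "Ck_on k (\<lambda>p. FD f (L p) (L v)) (L -` S)" for v by (rule Suc.IH[OF Ck_deriv[OF Suc.prems]])
  qed
qed

lemma Ck_bounded_linear:
  assumes "bounded_linear L" "open S"
  shows "Ck_on k L S"
proof (cases k)
  case 0 thus ?thesis using assms by (simp add: linear_continuous_on)
next
  case (Suc n)
  show ?thesis unfolding Suc
    by (rule Ck_SucI[where D = "\<lambda>_. L"]) (use assms in \<open>auto intro: Ck_const bounded_linear_imp_has_derivative\<close>)
qed

lemma Ck_sum: "open S \<Longrightarrow> (\<And>i. i \<in> A \<Longrightarrow> Ck_on k (f i) S) \<Longrightarrow> Ck_on k (\<lambda>x. \<Sum>i\<in>A. f i x) S"
  by (induction A rule: infinite_finite_induct) (auto intro: Ck_const Ck_add)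

context kaehler_coefficients
begin

lemma geodesic_exists:
  assumes z: "z \<in> \<Omega>"
  obtains x x' T where "0 < T" "x 0 = z" "x' 0 = v"
    "\<And>t. t \<in> {-T<..<T} \<Longrightarrow> x t \<in> \<Omega>"
    "\<And>t. t \<in> {-T<..<T} \<Longrightarrow> (x has_vector_derivative x' t) (at t)"
    "\<And>t. t \<in> {-T<..<T} \<Longrightarrow> (x' has_vector_derivative geod_acc (x t) (x' t)) (at t)"
proof -
  (* The geodesic equation as a first-order system for position and velocity. *)
  define F where "F p = (snd p, geod_acc (fst p) (snd p))" for p :: "(complex^2) \<times> (complex^2)"
  let ?U = "fst -` \<Omega> :: ((complex^2) \<times> (complex^2)) set"
  have oU: "open ?U" using open_dom by (simp add: open_vimage continuous_on_fst)
  have nth: "Ck_on n (\<lambda>p :: (complex^2) \<times> (complex^2). snd p $ m) ?U" for n m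
    by (intro Ck_bounded_linear[OF _ oU] bounded_linear_compose[OF bounded_linear_vec_nth bounded_linear_snd])
  have G: "Ck_on n (\<lambda>p :: (complex^2) \<times> (complex^2). chr_coeff m k i (fst p)) ?U" for n m k i
    by (rule Ck_compose_linear[OF bounded_linear_fst open_dom chr_coeff_smooth])
  have a: "Ck_on n (\<lambda>p :: (complex^2) \<times> (complex^2). geod_acc (fst p) (snd p) $ m) ?U" for n m
  proof -
    have "Ck_on n (\<lambda>p. (-1) * (\<Sum>k\<in>UNIV. \<Sum>i\<in>UNIV. chr_coeff m k i (fst p) * (snd p $ k * snd p $ i))) ?U"
      by (intro Ck_mult Ck_const oU Ck_sum G nth)
    thus ?thesis by (rule Ck_cong[OF oU]) (simp add: geod_acc_def)
  qed
  have b: "bounded_linear (\<lambda>x. (0, axis m x) :: (complex^2) \<times> (complex^2))" for m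
    by (intro bounded_linear_Pair bounded_linear_zero bounded_linear_axis)
  have s: "bounded_linear (\<lambda>p. (snd p, 0) :: (complex^2) \<times> (complex^2))"
    by (intro bounded_linear_Pair bounded_linear_zero bounded_linear_snd)
  have "Ck_on (Suc 0) (\<lambda>p. (snd p, 0) + (\<Sum>m\<in>UNIV. (0, axis m (geod_acc (fst p) (snd p) $ m)))) ?U"
    by (intro Ck_add oU Ck_sum Ck_linear[OF b] a Ck_bounded_linear[OF s])
  hence "Ck_on (Suc 0) F ?U"
    by (rule Ck_cong[OF oU])
       (simp add: F_def sum_2 vec_eq_iff forall_2 axis_def prod_eq_iff)
  moreover obtain r where r: "0 < r" "cball (z, v) r \<subseteq> ?U"
    using oU z open_contains_cball by (metis fst_conv vimageI)
  ultimately obtain L where L: "0 \<le> L" "\<And>p q. p \<in> cball (z, v) r \<Longrightarrow> q \<in> cball (z, v) r \<Longrightarrow> norm (F p - F q) \<le> L * norm (p - q)"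
    using C1_lipschitz_ball[OF oU] by blast
  obtain \<gamma> T where T: "0 < T" "\<gamma> 0 = (z, v)"
    and \<gamma>: "\<And>t. t \<in> {-T<..<T} \<Longrightarrow> \<gamma> t \<in> cball (z, v) r \<and> (\<gamma> has_vector_derivative F (\<gamma> t)) (at t)"
    using picard_local[OF L(2) r(1) L(1)] by blast
  show thesis
  proof (rule that[OF T(1)])
    show "fst (\<gamma> 0) = z" "snd (\<gamma> 0) = v" using T(2) by auto
    fix t assume t: "t \<in> {-T<..<T}"
    show "fst (\<gamma> t) \<in> \<Omega>" using \<gamma>[OF t] r(2) by blast
    show "((\<lambda>t. fst (\<gamma> t)) has_vector_derivative snd (\<gamma> t)) (at t)"
      using bounded_linear.has_vector_derivative[OF bounded_linear_fst conjunct2[OF \<gamma>[OF t]]] by (simp add: F_def)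
    show "((\<lambda>t. snd (\<gamma> t)) has_vector_derivative geod_acc (fst (\<gamma> t)) (snd (\<gamma> t))) (at t)"
      using bounded_linear.has_vector_derivative[OF bounded_linear_snd conjunct2[OF \<gamma>[OF t]]] by (simp add: F_def)
  qed
qed

lemma geod_acc_derivative:
  assumes xz: "x t \<in> \<Omega>"
    and x: "(x has_vector_derivative x' t) (at t)"
    and x': "(x' has_vector_derivative a) (at t)"
  shows "((\<lambda>t. geod_acc (x t) (x' t)) has_vector_derivative
    (\<chi> m. - (\<Sum>k\<in>UNIV. \<Sum>i\<in>UNIV. (\<Sum>l\<in>UNIV. d_hol l (chr_coeff m k i) (x t) * x' t $ l + d_bar l (chr_coeff m k i) (x t) * cnj (x' t $ l)) * (x' t $ k * x' t $ i)
      + chr_coeff m k i (x t) * (a $ k * x' t $ i + x' t $ k * a $ i)))) (at t)"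
proof -
  have G: "((\<lambda>t. chr_coeff m k i (x t)) has_vector_derivative
      (\<Sum>l\<in>UNIV. d_hol l (chr_coeff m k i) (x t) * x' t $ l + d_bar l (chr_coeff m k i) (x t) * cnj (x' t $ l))) (at t)" for m k i
  proof -
    have d: "chr_coeff m k i differentiable at (x t)" by (rule Ck_diff[OF open_dom chr_coeff_smooth xz])
    have "((\<lambda>s. chr_coeff m k i (x s)) has_derivative (\<lambda>h. FD (chr_coeff m k i) (x t) (h *\<^sub>R x' t))) (at t)"
      by (rule has_derivative_compose[where f = x and g = "chr_coeff m k i", OF _ FD_works[OF d]]) (use x in \<open>simp add: has_vector_derivative_def\<close>)
    moreover have "FD (chr_coeff m k i) (x t) (h *\<^sub>R x' t) = h *\<^sub>R (\<Sum>l\<in>UNIV. d_hol l (chr_coeff m k i) (x t) * x' t $ l + d_bar l (chr_coeff m k i) (x t) * cnj (x' t $ l))" for h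
      using linear_cmul[OF linear_frechet_derivative[OF d]] FD_wirtinger[OF d, of "x' t"] by simp
    ultimately show ?thesis by (simp add: has_vector_derivative_def)
  qed
  have n: "((\<lambda>t. x' t $ k) has_vector_derivative a $ k) (at t)" for k
    by (rule bounded_linear.has_vector_derivative[OF bounded_linear_vec_nth x'])
  have c: "((\<lambda>t. geod_acc (x t) (x' t) $ m) has_vector_derivative
     - (\<Sum>k\<in>UNIV. \<Sum>i\<in>UNIV. (\<Sum>l\<in>UNIV. d_hol l (chr_coeff m k i) (x t) * x' t $ l + d_bar l (chr_coeff m k i) (x t) * cnj (x' t $ l)) * (x' t $ k * x' t $ i)
      + chr_coeff m k i (x t) * (a $ k * x' t $ i + x' t $ k * a $ i))) (at t)" for m
  proof -
    let ?D = "\<lambda>k i. \<Sum>l\<in>UNIV. d_hol l (chr_coeff m k i) (x t) * x' t $ l + d_bar l (chr_coeff m k i) (x t) * cnj (x' t $ l)"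
    have "((\<lambda>t. - (\<Sum>k\<in>UNIV. \<Sum>i\<in>UNIV. chr_coeff m k i (x t) * (x' t $ k * x' t $ i))) has_vector_derivative
       - (\<Sum>k\<in>UNIV. \<Sum>i\<in>UNIV. chr_coeff m k i (x t) * (x' t $ k * a $ i + a $ k * x' t $ i) + ?D k i * (x' t $ k * x' t $ i))) (at t)"
      by (intro has_vector_derivative_minus has_vector_derivative_sum has_vector_derivative_mult G n)
    thus ?thesis unfolding geod_acc_def vec_lambda_beta by (simp add: add.commute)
  qed
  have v: "(\<lambda>t. geod_acc (x t) (x' t)) = (\<lambda>t. \<Sum>m\<in>UNIV. axis m (geod_acc (x t) (x' t) $ m))"
    by (simp add: fun_eq_iff vec_eq_iff sum_2 forall_2 axis_def)
  show ?thesis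
    apply (subst v)
    apply (rule has_vector_derivative_eq_rhs)
     apply (rule has_vector_derivative_sum)
     apply (rule bounded_linear.has_vector_derivative[OF bounded_linear_axis c])
    apply (simp add: vec_eq_iff forall_2 axis_def sum_component)
    done
qed

text \<open>
  The geodesic through \<open>z\<close> with any prescribed velocity exists and lies on a circle or a line, so
  \<open>circle_jerk\<close> at time 0 supplies the hypothesis of \<open>jerk_condition_algebra\<close>. The conclusion is that
  complex lines are totally geodesic.
\<close>

lemma acceleration_along_velocity:
  assumes z: "z \<in> \<Omega>" and g: "\<And>x v w. x \<in> \<Omega> \<Longrightarrow> g x v w = Re (herm_form H x v w)"
    and circ: "\<And>I \<gamma>. geodesic_on \<Omega> g I \<gamma> \<Longrightarrow> \<exists>S. (round_circle S \<or> straight_line S) \<and> \<gamma> ` I \<subseteq> S"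
  shows "chr_coeff 2 1 1 z = 0" "chr_coeff 1 2 2 z = 0" "chr_coeff 1 1 1 z = chr_coeff 2 1 2 z + chr_coeff 2 2 1 z"
    "chr_coeff 2 2 2 z = chr_coeff 1 1 2 z + chr_coeff 1 2 1 z"
proof -
  have cond: "of_real ((norm v)\<^sup>2) * (v $ 1 * J $ 2 - v $ 2 * J $ 1)
      = 3 * of_real (Re (\<Sum>k\<in>UNIV. v $ k * cnj (geod_acc z v $ k))) * (v $ 1 * geod_acc z v $ 2 - v $ 2 * geod_acc z v $ 1)"
    if J: "J = (\<chi> m. - (\<Sum>k\<in>UNIV. \<Sum>i\<in>UNIV. (\<Sum>l\<in>UNIV. d_hol l (chr_coeff m k i) z * v $ l + d_bar l (chr_coeff m k i) z * cnj (v $ l)) * (v $ k * v $ i)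
      + chr_coeff m k i z * (geod_acc z v $ k * v $ i + v $ k * geod_acc z v $ i)))" for v J
  proof -
    obtain x x' T where T: "0 < T" "x 0 = z" "x' 0 = v"
      and x: "\<And>t. t \<in> {-T<..<T} \<Longrightarrow> x t \<in> \<Omega>"
        "\<And>t. t \<in> {-T<..<T} \<Longrightarrow> (x has_vector_derivative x' t) (at t)"
        "\<And>t. t \<in> {-T<..<T} \<Longrightarrow> (x' has_vector_derivative geod_acc (x t) (x' t)) (at t)"
      using geodesic_exists[OF z, of v] by blast
    have "geodesic_on \<Omega> g {-T<..<T} x"
      unfolding geodesic_on_def
    proof (intro conjI exI[of _ x'] ballI)
      fix t assume t: "t \<in> {-T<..<T}"
      show "(x' has_vector_derivative - christoffel g (x t) (x' t) (x' t)) (at t)"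
        using x(3)[OF t] koszul[OF x(1)[OF t] g] by simp
    qed (use x in \<open>auto simp: is_interval_oo\<close>)
    then obtain S where S: "round_circle S \<or> straight_line S" "x ` {-T<..<T} \<subseteq> S" using circ by blast
    have 0: "0 \<in> {-T<..<T}" using T by auto
    note x3 = geod_acc_derivative[OF x(1) x(2) x(3)]
    from circle_jerk[OF S open_greaterThanLessThan 0 x(2) x(3) x3]
    obtain y k l where y: "(norm v)\<^sup>2 *\<^sub>R J - (3 * (v \<bullet> geod_acc z v)) *\<^sub>R geod_acc z v = k *\<^sub>R y" "v = l *\<^sub>R y"
      unfolding T J by blast
    define Y where "Y = (norm v)\<^sup>2 *\<^sub>R J - (3 * (v \<bullet> geod_acc z v)) *\<^sub>R geod_acc z v"
    have "v $ 1 * Y $ 2 - v $ 2 * Y $ 1 = 0" unfolding Y_def y(1) by (subst (1 2) y(2)) simp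
    moreover have "v \<bullet> geod_acc z v = Re (\<Sum>k\<in>UNIV. v $ k * cnj (geod_acc z v $ k))"
      by (simp add: inner_vec_def inner_complex_def sum_2)
    moreover have "Y $ m = of_real ((norm v)\<^sup>2) * J $ m - of_real (3 * (v \<bullet> geod_acc z v)) * geod_acc z v $ m" for m
      unfolding Y_def vector_minus_component vector_scaleR_component scaleR_conv_of_real[where 'a = complex] ..
    ultimately have "v $ 1 * (of_real ((norm v)\<^sup>2) * J $ 2 - 3 * of_real (Re (\<Sum>k\<in>UNIV. v $ k * cnj (geod_acc z v $ k))) * geod_acc z v $ 2)
        - v $ 2 * (of_real ((norm v)\<^sup>2) * J $ 1 - 3 * of_real (Re (\<Sum>k\<in>UNIV. v $ k * cnj (geod_acc z v $ k))) * geod_acc z v $ 1) = 0"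
      by simp
    thus ?thesis by (simp only: algebra_simps add_0_left add_0_right)
  qed
  have c: "of_real ((norm v)\<^sup>2) * (v $ 1 * - (\<Sum>k\<in>UNIV. \<Sum>i\<in>UNIV. (\<Sum>l\<in>UNIV. d_hol l (chr_coeff 2 k i) z * v $ l + d_bar l (chr_coeff 2 k i) z * cnj (v $ l)) * (v $ k * v $ i)
      + chr_coeff 2 k i z * (geod_acc z v $ k * v $ i + v $ k * geod_acc z v $ i))
      - v $ 2 * - (\<Sum>k\<in>UNIV. \<Sum>i\<in>UNIV. (\<Sum>l\<in>UNIV. d_hol l (chr_coeff 1 k i) z * v $ l + d_bar l (chr_coeff 1 k i) z * cnj (v $ l)) * (v $ k * v $ i)
      + chr_coeff 1 k i z * (geod_acc z v $ k * v $ i + v $ k * geod_acc z v $ i)))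
      = 3 * of_real (Re (\<Sum>k\<in>UNIV. v $ k * cnj (geod_acc z v $ k))) * (v $ 1 * geod_acc z v $ 2 - v $ 2 * geod_acc z v $ 1)" for v
    using cond[OF refl, of v] by simp
  note r = jerk_condition_algebra[where G = "\<lambda>m k i. chr_coeff m k i z" and p = "\<lambda>m k i l. d_hol l (chr_coeff m k i) z"
      and q = "\<lambda>m k i l. d_bar l (chr_coeff m k i) z", OF c[unfolded geod_acc_def vec_lambda_beta]]
  show "chr_coeff 2 1 1 z = 0" "chr_coeff 1 2 2 z = 0" "chr_coeff 1 1 1 z = chr_coeff 2 1 2 z + chr_coeff 2 2 1 z"
    "chr_coeff 2 2 2 z = chr_coeff 1 1 2 z + chr_coeff 1 2 1 z" by (rule r)+
qed

end

section \<open>Integration of the metric\<close>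

lemma Ck_coordinate: "Ck_on n (\<lambda>z :: complex^2. z $ m - c) S" if "open S" for S
proof -
  have "Ck_on n (\<lambda>z. z $ m + (- c)) S"
    by (intro Ck_add that Ck_const Ck_bounded_linear[OF bounded_linear_vec_nth that])
  thus ?thesis by simp
qed

text \<open>
  The equations for \<open>F 1, F 2\<close> force them to be affine in the holomorphic variables with antiholomorphic
  coefficients: the common slope \<open>Q\<close> has \<open>\<partial>\<^sub>1 Q = - \<partial>\<^sub>2 \<partial>\<^sub>1 F 1 = 0\<close> and \<open>\<partial>\<^sub>2 Q = \<partial>\<^sub>1 \<partial>\<^sub>2 F 2 = 0\<close>, and the
  intercepts \<open>R\<close> and \<open>S\<close> inherit this. The base point \<open>p\<close> is arbitrary.
\<close>

lemma antiholomorphic_decomposition: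
  fixes F :: "2 \<Rightarrow> complex^2 \<Rightarrow> complex" and p :: "complex^2"
  assumes U: "open U" and C: "\<And>n i. Ck_on n (F i) U"
    and 11: "\<And>z. z \<in> U \<Longrightarrow> d_hol 1 (F 1) z = 0" and 22: "\<And>z. z \<in> U \<Longrightarrow> d_hol 2 (F 2) z = 0"
    and 12: "\<And>z. z \<in> U \<Longrightarrow> d_hol 2 (F 1) z = - d_hol 1 (F 2) z"
  defines "Q \<equiv> d_hol 1 (F 2)"
  defines "R \<equiv> \<lambda>z. F 1 z + Q z * (z $ 2 - p $ 2)"
  defines "S \<equiv> \<lambda>z. F 2 z - Q z * (z $ 1 - p $ 1)"
  shows "(\<forall>n. Ck_on n Q U \<and> Ck_on n R U \<and> Ck_on n S U) \<and>
    (\<forall>z\<in>U. \<forall>k. d_hol k Q z = 0 \<and> d_hol k R z = 0 \<and> d_hol k S z = 0)"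
proof -
  have CQ: "Ck_on n Q U" for n unfolding Q_def by (rule Ck_wirtinger[OF U C])
  have CR: "Ck_on n R U" for n unfolding R_def by (intro Ck_add Ck_mult U C CQ Ck_coordinate)
  have CS: "Ck_on n S U" for n
  proof -
    have "Ck_on n (\<lambda>z. F 2 z + (-1) * (Q z * (z $ 1 - p $ 1))) U"
      by (intro Ck_add Ck_mult Ck_const U C CQ Ck_coordinate)
    thus ?thesis unfolding S_def by simp
  qed
  have Q1: "d_hol 1 Q z = 0" if z: "z \<in> U" for z
  proof -
    have "d_hol 1 Q z = d_hol 1 (\<lambda>z. - 1 * d_hol 2 (F 1) z) z" unfolding Q_def
      by (rule wirtinger_cong[OF U z]) (simp add: 12)
    also have "\<dots> = - d_hol 1 (d_hol 2 (F 1)) z"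
      by (subst wirtinger_mult) (auto intro: Ck_diff[OF U Ck_wirtinger(1)[OF U C] z])
    also have "d_hol 1 (d_hol 2 (F 1)) z = d_hol 2 (d_hol 1 (F 1)) z" by (rule wirtinger_commute[OF U C z])
    also have "\<dots> = d_hol 2 (\<lambda>z. 0) z" by (rule wirtinger_cong[OF U z]) (rule 11)
    finally show ?thesis by simp
  qed
  have Q2: "d_hol 2 Q z = 0" if z: "z \<in> U" for z
  proof -
    have "d_hol 2 Q z = d_hol 1 (d_hol 2 (F 2)) z" unfolding Q_def by (rule wirtinger_commute[OF U C z])
    also have "\<dots> = d_hol 1 (\<lambda>z. 0) z" by (rule wirtinger_cong[OF U z]) (rule 22)
    finally show ?thesis by simp
  qed
  have Q: "d_hol k Q z = 0" if "z \<in> U" for z k using Q1[OF that] Q2[OF that] exhaust_2[of k] by auto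
  have dF: "F i differentiable at z" if "z \<in> U" for i z using Ck_diff[OF U C that] .
  have dQ: "Q differentiable at z" if "z \<in> U" for z using Ck_diff[OF U CQ that] .
  have dQc: "(\<lambda>z. Q z * (z $ m - c)) differentiable at z" if "z \<in> U" for m c z
    using dQ[OF that] wirtinger_coordinate(1) by (rule differentiable_mult)
  have Qc: "d_hol k (\<lambda>z. Q z * (z $ m - c)) z = (if k = m then Q z else 0)" if "z \<in> U" for k m c z
    using wirtinger_mult(1)[OF dQ[OF that] wirtinger_coordinate(1)] Q[OF that] wirtinger_coordinate(2)[of k m c z] by simp
  have "d_hol k R z = 0" if z: "z \<in> U" for z k
    unfolding R_def wirtinger_add(1)[OF dF[OF z] dQc[OF z]] Qc[OF z]
    using exhaust_2[of k] 11[OF z] 12[OF z] by (auto simp: Q_def)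
  moreover have "d_hol k S z = 0" if z: "z \<in> U" for z k
    unfolding S_def wirtinger_diff(1)[OF dF[OF z] dQc[OF z]] Qc[OF z]
    using exhaust_2[of k] 22[OF z] by (auto simp: Q_def)
  ultimately show ?thesis using CQ CR CS Q by blast
qed

text \<open>
  The conjugates of \<open>X 1, X 2\<close> are holomorphic, hence so are their slope and intercepts, and these are
  antiholomorphic by \<open>antiholomorphic_decomposition\<close>: they are constants.
\<close>

lemma antiaffine:
  fixes X :: "2 \<Rightarrow> complex^2 \<Rightarrow> complex" and p :: "complex^2"
  assumes U: "open U" "connected U" and C: "\<And>n i. Ck_on n (X i) U"
    and d: "\<And>z k i. z \<in> U \<Longrightarrow> d_hol k (X i) z = 0"
    and 11: "\<And>z. z \<in> U \<Longrightarrow> d_bar 1 (X 1) z = 0" and 22: "\<And>z. z \<in> U \<Longrightarrow> d_bar 2 (X 2) z = 0"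
    and 12: "\<And>z. z \<in> U \<Longrightarrow> d_bar 2 (X 1) z = - d_bar 1 (X 2) z"
  shows "\<exists>q r s. \<forall>z\<in>U. X 1 z = r - q * cnj (z $ 2 - p $ 2) \<and> X 2 z = s + q * cnj (z $ 1 - p $ 1)"
proof -
  define F where "F i z = cnj (X i z)" for i z
  have CF: "Ck_on n (F i) U" for n i unfolding F_def by (intro Ck_linear[OF bounded_linear_cnj] U C)
  have dX: "X i differentiable at z" if "z \<in> U" for i z using Ck_diff[OF U(1) C that] .
  have wF: "d_hol k (F i) z = cnj (d_bar k (X i) z)" "d_bar k (F i) z = 0" if "z \<in> U" for k i z
    unfolding F_def using wirtinger_cnj[OF dX[OF that]] d[OF that] by auto
  (* The d_bar-derivatives of F vanish, so those of Q, R and S do too. *)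
  define Q where "Q = d_hol 1 (F 2)"
  define R where "R = (\<lambda>z. F 1 z + Q z * (z $ 2 - p $ 2))"
  define S where "S = (\<lambda>z. F 2 z - Q z * (z $ 1 - p $ 1))"
  have dec: "\<And>n. Ck_on n Q U" "\<And>n. Ck_on n R U" "\<And>n. Ck_on n S U"
    "\<And>z k. z \<in> U \<Longrightarrow> d_hol k Q z = 0" "\<And>z k. z \<in> U \<Longrightarrow> d_hol k R z = 0" "\<And>z k. z \<in> U \<Longrightarrow> d_hol k S z = 0"
  proof -
    have "d_hol 1 (F 1) z = 0" "d_hol 2 (F 2) z = 0" "d_hol 2 (F 1) z = - d_hol 1 (F 2) z" if "z \<in> U" for z
      using wF[OF that] 11[OF that] 22[OF that] 12[OF that] by simp_all
    note D = antiholomorphic_decomposition[OF U(1) CF this, where p = p, folded Q_def R_def S_def, folded R_def S_def]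
    show "Ck_on n Q U" "Ck_on n R U" "Ck_on n S U" for n using D by blast+
    show "d_hol k Q z = 0" "d_hol k R z = 0" "d_hol k S z = 0" if "z \<in> U" for z k using D that by blast+
  qed
  have bQ: "d_bar k Q z = 0" if z: "z \<in> U" for k z
  proof -
    have "d_bar k Q z = d_hol 1 (d_bar k (F 2)) z" unfolding Q_def by (rule wirtinger_commute[OF U(1) CF z])
    also have "\<dots> = d_hol 1 (\<lambda>z. 0) z" by (rule wirtinger_cong[OF U(1) z]) (rule wF)
    finally show ?thesis by simp
  qed
  have dF: "F i differentiable at z" if "z \<in> U" for i z using Ck_diff[OF U(1) CF that] .
  have dQ: "Q differentiable at z" if "z \<in> U" for z using Ck_diff[OF U(1) dec(1) that] .
  have dQc: "(\<lambda>z. Q z * (z $ m - c)) differentiable at z" if "z \<in> U" for m c z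
    using dQ[OF that] wirtinger_coordinate(1) by (rule differentiable_mult)
  have Qc: "d_bar k (\<lambda>z. Q z * (z $ m - c)) z = 0" if "z \<in> U" for k m c z
    using wirtinger_mult(2)[OF dQ[OF that] wirtinger_coordinate(1)] bQ[OF that] wirtinger_coordinate(3)[of k m c z] by simp
  have bR: "d_bar k R z = 0" if z: "z \<in> U" for z k
    unfolding R_def wirtinger_add(2)[OF dF[OF z] dQc[OF z]] Qc[OF z] using wF(2)[OF z] by simp
  have bS: "d_bar k S z = 0" if z: "z \<in> U" for z k
    unfolding S_def wirtinger_diff(2)[OF dF[OF z] dQc[OF z]] Qc[OF z] using wF(2)[OF z] by simp
  obtain q where q: "\<And>z. z \<in> U \<Longrightarrow> Q z = q" using constant_if_wirtinger_0[OF U dec(1) dec(4) bQ] by blast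
  obtain r where r: "\<And>z. z \<in> U \<Longrightarrow> R z = r" using constant_if_wirtinger_0[OF U dec(2) dec(5) bR] by blast
  obtain s where s: "\<And>z. z \<in> U \<Longrightarrow> S z = s" using constant_if_wirtinger_0[OF U dec(3) dec(6) bS] by blast
  show ?thesis
  proof (intro exI ballI conjI)
    fix z assume z: "z \<in> U"
    have "F 1 z = r - q * (z $ 2 - p $ 2)" using r[OF z] q[OF z] unfolding R_def by (simp add: algebra_simps)
    thus "X 1 z = cnj r - cnj q * cnj (z $ 2 - p $ 2)" unfolding F_def
      by (metis complex_cnj_cnj complex_cnj_diff complex_cnj_mult)
    have "F 2 z = s + q * (z $ 1 - p $ 1)" using s[OF z] q[OF z] unfolding S_def by (simp add: algebra_simps)
    thus "X 2 z = cnj s + cnj q * cnj (z $ 1 - p $ 1)" unfolding F_def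
      by (metis complex_cnj_cnj complex_cnj_add complex_cnj_mult)
  qed
qed

text \<open>
  The cross product of \<open>(1, z)\<close> and \<open>(0, v)\<close>: the coordinates, in the dual projective plane, of the line
  through \<open>z\<close> with direction \<open>v\<close>.
\<close>

definition line_coords :: "complex^2 \<Rightarrow> complex^2 \<Rightarrow> complex^3" where
  "line_coords z v = vector [z $ 1 * v $ 2 - z $ 2 * v $ 1, - v $ 2, v $ 1]"

definition sesq :: "(3 \<Rightarrow> 3 \<Rightarrow> complex) \<Rightarrow> complex^3 \<Rightarrow> complex^3 \<Rightarrow> complex" where
  "sesq M x y = (\<Sum>a\<in>UNIV. \<Sum>b\<in>UNIV. x $ a * M a b * cnj (y $ b))"

text \<open>
  \<open>antiholomorphic_decomposition\<close> in the first index and, using Hermitian symmetry, \<open>antiaffine\<close> in the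
  second show that \<open>N\<close> is affine in \<open>z\<close> and affine in \<open>cnj z\<close>, with constant coefficients. The shape of
  these affine functions is that of \<open>line_coords\<close>. The resulting matrix \<open>M0\<close> is replaced by its
  Hermitian part.
\<close>

lemma codazzi_solution:
  fixes N :: "2 \<Rightarrow> 2 \<Rightarrow> complex^2 \<Rightarrow> complex" and p :: "complex^2"
  assumes U: "open U" "connected U" and C: "\<And>n i j. Ck_on n (N i j) U"
    and herm_form: "\<And>z i j. z \<in> U \<Longrightarrow> N j i z = cnj (N i j z)"
    and 11: "\<And>z j. z \<in> U \<Longrightarrow> d_hol 1 (N 1 j) z = 0" and 22: "\<And>z j. z \<in> U \<Longrightarrow> d_hol 2 (N 2 j) z = 0"
    and 12: "\<And>z j. z \<in> U \<Longrightarrow> d_hol 2 (N 1 j) z = - d_hol 1 (N 2 j) z"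
  obtains M where "\<And>a b. M b a = cnj (M a b)"
    "\<And>z v w. z \<in> U \<Longrightarrow> herm_form N z v w = sesq M (line_coords (z - p) v) (line_coords (z - p) w)"
proof -
  define Q where "Q j = d_hol 1 (N 2 j)" for j
  define R where "R j = (\<lambda>z. N 1 j z + Q j z * (z $ 2 - p $ 2))" for j
  define S where "S j = (\<lambda>z. N 2 j z - Q j z * (z $ 1 - p $ 1))" for j
  have "(\<forall>n. Ck_on n (Q j) U \<and> Ck_on n (R j) U \<and> Ck_on n (S j) U) \<and>
    (\<forall>z\<in>U. \<forall>k. d_hol k (Q j) z = 0 \<and> d_hol k (R j) z = 0 \<and> d_hol k (S j) z = 0)" for j
    using antiholomorphic_decomposition[OF U(1), where p = p and F = "\<lambda>i. N i j", OF C 11 22 12]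
    unfolding Q_def R_def S_def .
  hence dec: "\<And>n j. Ck_on n (Q j) U" "\<And>n j. Ck_on n (R j) U" "\<And>n j. Ck_on n (S j) U"
    "\<And>z k j. z \<in> U \<Longrightarrow> d_hol k (Q j) z = 0" "\<And>z k j. z \<in> U \<Longrightarrow> d_hol k (R j) z = 0" "\<And>z k j. z \<in> U \<Longrightarrow> d_hol k (S j) z = 0"
    by blast+
  have dN: "N i j differentiable at z" if "z \<in> U" for i j z using Ck_diff[OF U(1) C that] .
  have dQ: "Q j differentiable at z" if "z \<in> U" for j z using Ck_diff[OF U(1) dec(1) that] .
  have wbN: "d_bar k (N i j) z = cnj (d_hol k (N j i) z)" if z: "z \<in> U" for k i j z
    using wirtinger_cong(2)[OF U(1) z, of "N i j" "\<lambda>z. cnj (N j i z)", OF herm_form] wirtinger_cnj(2)[OF dN[OF z]] by metis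
  have b11: "d_bar 1 (N i 1) z = 0" and b22: "d_bar 2 (N i 2) z = 0" and b12: "d_bar 2 (N i 1) z = - d_bar 1 (N i 2) z"
    if z: "z \<in> U" for i z using 11[OF z] 22[OF z] 12[OF z] by (auto simp: wbN[OF z])
  have bQ: "d_bar k (Q j) z = d_hol 1 (d_bar k (N 2 j)) z" if z: "z \<in> U" for k j z
    unfolding Q_def by (rule wirtinger_commute[OF U(1) C z])
  have Q11: "d_bar 1 (Q 1) z = 0" and Q22: "d_bar 2 (Q 2) z = 0" and Q12: "d_bar 2 (Q 1) z = - d_bar 1 (Q 2) z"
    if z: "z \<in> U" for z
  proof -
    have "d_hol 1 (d_bar 1 (N 2 1)) z = d_hol 1 (\<lambda>z. 0) z" by (rule wirtinger_cong[OF U(1) z]) (rule b11)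
    thus "d_bar 1 (Q 1) z = 0" using bQ[OF z] by simp
    have "d_hol 1 (d_bar 2 (N 2 2)) z = d_hol 1 (\<lambda>z. 0) z" by (rule wirtinger_cong[OF U(1) z]) (rule b22)
    thus "d_bar 2 (Q 2) z = 0" using bQ[OF z] by simp
    have "d_hol 1 (d_bar 2 (N 2 1)) z = d_hol 1 (\<lambda>z. - 1 * d_bar 1 (N 2 2) z) z"
      by (rule wirtinger_cong[OF U(1) z]) (simp add: b12)
    also have "\<dots> = - d_hol 1 (d_bar 1 (N 2 2)) z"
      by (subst wirtinger_mult) (auto intro: Ck_diff[OF U(1) Ck_wirtinger(2)[OF U(1) C] z])
    finally show "d_bar 2 (Q 1) z = - d_bar 1 (Q 2) z" using bQ[OF z] by simp
  qed
  have dQc: "(\<lambda>z. Q j z * (z $ m - c)) differentiable at z" if "z \<in> U" for j m c z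
    using dQ[OF that] wirtinger_coordinate(1) by (rule differentiable_mult)
  have Qc: "d_bar k (\<lambda>z. Q j z * (z $ m - c)) z = d_bar k (Q j) z * (z $ m - c)" if "z \<in> U" for k j m c z
    using wirtinger_mult(2)[OF dQ[OF that] wirtinger_coordinate(1)] wirtinger_coordinate(3)[of k m c z] by simp
  have bR: "d_bar k (R j) z = d_bar k (N 1 j) z + d_bar k (Q j) z * (z $ 2 - p $ 2)" if z: "z \<in> U" for k j z
    unfolding R_def wirtinger_add(2)[OF dN[OF z] dQc[OF z]] Qc[OF z] ..
  have bS: "d_bar k (S j) z = d_bar k (N 2 j) z - d_bar k (Q j) z * (z $ 1 - p $ 1)" if z: "z \<in> U" for k j z
    unfolding S_def wirtinger_diff(2)[OF dN[OF z] dQc[OF z]] Qc[OF z] ..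
  obtain q0 r0 s0 where Q: "\<forall>z\<in>U. Q 1 z = r0 - q0 * cnj (z $ 2 - p $ 2) \<and> Q 2 z = s0 + q0 * cnj (z $ 1 - p $ 1)"
  proof -
    have "\<exists>q r s. \<forall>z\<in>U. Q 1 z = r - q * cnj (z $ 2 - p $ 2) \<and> Q 2 z = s + q * cnj (z $ 1 - p $ 1)"
      by (rule antiaffine[OF U dec(1) dec(4) Q11 Q22 Q12])
    thus thesis by (elim exE) (rule that)
  qed
  obtain q1 r1 s1 where R: "\<forall>z\<in>U. R 1 z = r1 - q1 * cnj (z $ 2 - p $ 2) \<and> R 2 z = s1 + q1 * cnj (z $ 1 - p $ 1)"
  proof -
    have "d_bar 1 (R 1) z = 0" "d_bar 2 (R 2) z = 0" "d_bar 2 (R 1) z = - d_bar 1 (R 2) z" if z: "z \<in> U" for z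
      unfolding bR[OF z] b11[OF z] b22[OF z] b12[OF z] Q11[OF z] Q22[OF z] Q12[OF z] by simp_all
    hence "\<exists>q r s. \<forall>z\<in>U. R 1 z = r - q * cnj (z $ 2 - p $ 2) \<and> R 2 z = s + q * cnj (z $ 1 - p $ 1)"
      by (intro antiaffine[OF U dec(2) dec(5)])
    thus thesis by (elim exE) (rule that)
  qed
  obtain q2 r2 s2 where S: "\<forall>z\<in>U. S 1 z = r2 - q2 * cnj (z $ 2 - p $ 2) \<and> S 2 z = s2 + q2 * cnj (z $ 1 - p $ 1)"
  proof -
    have "d_bar 1 (S 1) z = 0" "d_bar 2 (S 2) z = 0" "d_bar 2 (S 1) z = - d_bar 1 (S 2) z" if z: "z \<in> U" for z
      unfolding bS[OF z] b11[OF z] b22[OF z] b12[OF z] Q11[OF z] Q22[OF z] Q12[OF z] by simp_all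
    hence "\<exists>q r s. \<forall>z\<in>U. S 1 z = r - q * cnj (z $ 2 - p $ 2) \<and> S 2 z = s + q * cnj (z $ 1 - p $ 1)"
      by (intro antiaffine[OF U dec(3) dec(6)])
    thus thesis by (elim exE) (rule that)
  qed
  (* Rows and columns follow the order (Q, -S, R) of the coefficients of the line coordinates. *)
  define M0 where "M0 a b = (if a = 1 then (if b = 1 then q0 else if b = 2 then - s0 else r0)
      else if a = 2 then (if b = 1 then - q2 else if b = 2 then s2 else - r2)
      else (if b = 1 then q1 else if b = 2 then - s1 else r1))" for a b :: 3
  have N: "N 1 j z = R j z - Q j z * (z $ 2 - p $ 2)" "N 2 j z = S j z + Q j z * (z $ 1 - p $ 1)" for j z
    by (simp_all add: R_def S_def)
  have M0: "herm_form N z v w = sesq M0 (line_coords (z - p) v) (line_coords (z - p) w)" if z: "z \<in> U" for z v w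
    unfolding herm_form_def sesq_def line_coords_def sum_2 sum_3 N
      conjunct1[OF bspec[OF Q z]] conjunct2[OF bspec[OF Q z]] conjunct1[OF bspec[OF R z]]
      conjunct2[OF bspec[OF R z]] conjunct1[OF bspec[OF S z]] conjunct2[OF bspec[OF S z]]
    by (simp add: M0_def algebra_simps)
  define M where "M a b = (M0 a b + cnj (M0 b a)) / 2" for a b
  have "herm_form N z v w = sesq M (line_coords (z - p) v) (line_coords (z - p) w)" if z: "z \<in> U" for z v w
  proof -
    have "herm_form N z v w = cnj (herm_form N z w v)"
      using herm_form[OF z, of 1 1] herm_form[OF z, of 2 2] herm_form[OF z, of 1 2]
      unfolding herm_form_def by (simp add: sum_2 algebra_simps)
    hence "herm_form N z v w = (herm_form N z v w + cnj (herm_form N z w v)) / 2" by simp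
    also have "\<dots> = sesq M (line_coords (z - p) v) (line_coords (z - p) w)"
      unfolding M0[OF z] sesq_def M_def sum_3 by (simp add: field_simps)
    finally show ?thesis .
  qed
  moreover have "M b a = cnj (M a b)" for a b by (simp add: M_def add.commute)
  ultimately show thesis using that by blast
qed

context kaehler_coefficients
begin

lemma chr_coeff_sym: "z \<in> \<Omega> \<Longrightarrow> chr_coeff m k i z = chr_coeff m i k z"
  unfolding chr_coeff_def using closed[of z k i] by simp

text \<open>
  The four equations say that \<open>\<partial>\<^sub>k H i j = l k * H i j + l i * H k j\<close> for some \<open>l\<close>. Hence
  \<open>\<partial>\<^sub>k (herm_det H) = 3 * l k * herm_det H\<close>, so that \<open>D\<close>, the power \<open>- 1/3\<close> of the determinant, has
  \<open>\<partial>\<^sub>k D = - l k * D\<close>, and \<open>N = D\<^sup>2 H\<close> satisfies the equations of \<open>codazzi_solution\<close>. The exponent also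
  makes \<open>D\<close> the determinant of \<open>N\<close>, so that \<open>M\<close> determines the metric.
\<close>

lemma projectively_flat_solution:
  assumes flat: "\<And>z. z \<in> \<Omega> \<Longrightarrow> chr_coeff 2 1 1 z = 0" "\<And>z. z \<in> \<Omega> \<Longrightarrow> chr_coeff 1 2 2 z = 0"
    "\<And>z. z \<in> \<Omega> \<Longrightarrow> chr_coeff 1 1 1 z = chr_coeff 2 1 2 z + chr_coeff 2 2 1 z"
    "\<And>z. z \<in> \<Omega> \<Longrightarrow> chr_coeff 2 2 2 z = chr_coeff 1 1 2 z + chr_coeff 1 2 1 z"
    and U: "open U" "connected U" "U \<subseteq> \<Omega>"
  shows "\<exists>M D. (\<forall>a b. M b a = cnj (M a b)) \<and> (\<forall>z\<in>U. 0 < D z \<and> D z = (D z)^4 * herm_det H z \<and>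
    (\<forall>v w. of_real ((D z)\<^sup>2) * herm_form H z v w = sesq M (line_coords (z - p) v) (line_coords (z - p) w)))"
proof -
  define h where "h = herm_det H"
  define b where "b = chr_coeff 2 1 2"
  define c where "c = chr_coeff 1 1 2"
  have hpos: "h z > 0" if "z \<in> \<Omega>" for z unfolding h_def using herm_det_pos[OF that] .
  have Ch: "Ck_on n h \<Omega>" for n unfolding h_def by (rule herm_det_smooth)
  have dh: "h differentiable at z" if "z \<in> \<Omega>" for z using Ck_diff[OF open_dom Ch that] .
  have H1: "d_hol 1 (H 1 j) z = 2 * b z * H 1 j z" and H12: "d_hol 1 (H 2 j) z = c z * H 1 j z + b z * H 2 j z"
    and H21: "d_hol 2 (H 1 j) z = c z * H 1 j z + b z * H 2 j z" and H2: "d_hol 2 (H 2 j) z = 2 * c z * H 2 j z"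
    if z: "z \<in> \<Omega>" for z j
    using chr_coeff_solves[OF z, of 1 1 j] chr_coeff_solves[OF z, of 1 2 j] chr_coeff_solves[OF z, of 2 1 j] chr_coeff_solves[OF z, of 2 2 j]
      flat[OF z] chr_coeff_sym[OF z, of _ 2 1] by (simp_all add: sum_2 b_def c_def)
  define l where "l k z = (if k = 1 then b z else c z)" for k :: 2 and z
  have wh: "d_hol k (\<lambda>z. of_real (h z)) z = 3 * l k z * of_real (h z)" if z: "z \<in> \<Omega>" for z k
  proof -
    have "d_hol k (\<lambda>z. of_real (h z)) z = d_hol k (\<lambda>z. H 1 1 z * H 2 2 z - H 1 2 z * H 2 1 z) z"
      by (rule wirtinger_cong[OF open_dom z]) (simp add: h_def herm_det_of_real)
    also have "\<dots> = d_hol k (H 1 1) z * H 2 2 z + H 1 1 z * d_hol k (H 2 2) z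
        - (d_hol k (H 1 2) z * H 2 1 z + H 1 2 z * d_hol k (H 2 1) z)"
      using diff[OF z] by (simp add: wirtinger_diff wirtinger_mult differentiable_mult)
    also have "\<dots> = 3 * l k z * (H 1 1 z * H 2 2 z - H 1 2 z * H 2 1 z)"
      using exhaust_2[of k] by (auto simp: l_def H1[OF z] H12[OF z] H21[OF z] H2[OF z] algebra_simps)
    finally show ?thesis unfolding h_def herm_det_of_real[OF z] .
  qed
  define r where "r z = complex_of_real (h z powr (- 2 / 3))" for z
  have Cr: "Ck_on n r \<Omega>" for n unfolding r_def
    by (intro Ck_linear[OF bounded_linear_of_real] Ck_powr open_dom Ch hpos)
  (* r is the square of D, hence the factor - 2. *)
  have wr: "d_hol k r z = - 2 * l k z * r z" if z: "z \<in> \<Omega>" for k z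
  proof -
    have "h z powr (- 2 / 3 - 1) * h z = h z powr (- 2 / 3)"
      using hpos[OF z] powr_add[of "h z" "- 2 / 3 - 1" 1] by simp
    hence "complex_of_real (h z powr (- 2 / 3 - 1)) * of_real (h z) = r z"
      unfolding r_def by (metis of_real_mult)
    moreover have "d_hol k r z = complex_of_real (- 2 / 3 * h z powr (- 2 / 3 - 1)) * (3 * l k z * of_real (h z))"
      unfolding r_def wirtinger_of_real_powr[OF dh[OF z] hpos[OF z]] wh[OF z] ..
    ultimately show ?thesis by (simp add: algebra_simps)
  qed
  define N where "N i j z = r z * H i j z" for i j z
  have wN: "d_hol k (N i j) z = r z * (d_hol k (H i j) z - 2 * l k z * H i j z)" if z: "z \<in> \<Omega>" for k i j z
    unfolding N_def wirtinger_mult(1)[OF Ck_diff[OF open_dom Cr z] diff[OF z]] wr[OF z] by (simp add: algebra_simps)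
  have CN: "Ck_on n (N i j) U" for n i j unfolding N_def
    using U(3) by (intro Ck_subset[OF Ck_mult[OF open_dom Cr smooth]])
  obtain M where M: "\<And>a b. M b a = cnj (M a b)"
    "\<And>z v w. z \<in> U \<Longrightarrow> herm_form N z v w = sesq M (line_coords (z - p) v) (line_coords (z - p) w)"
  proof (rule codazzi_solution[OF U(1,2) CN, where p = p])
    fix z assume "z \<in> U" hence z: "z \<in> \<Omega>" using U(3) by blast
    show "N j i z = cnj (N i j z)" for i j using hermitian[OF z, of j i] by (simp add: N_def r_def)
    show "d_hol 1 (N 1 j) z = 0" "d_hol 2 (N 2 j) z = 0" "d_hol 2 (N 1 j) z = - d_hol 1 (N 2 j) z" for j
      unfolding wN[OF z] H1[OF z] H12[OF z] H21[OF z] H2[OF z] by (simp_all add: l_def algebra_simps)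
  qed blast
  define D where "D z = h z powr (- 1 / 3)" for z
  show ?thesis
  proof (intro exI[of _ M] exI[of _ D] conjI ballI allI)
    show "M b a = cnj (M a b)" for a b by (rule M(1))
    fix z assume zU: "z \<in> U" hence z: "z \<in> \<Omega>" using U(3) by blast
    show "0 < D z" using hpos[OF z] by (simp add: D_def)
    have D2: "(D z)\<^sup>2 = h z powr (- 2 / 3)"
      using hpos[OF z] by (simp add: D_def powr_power)
    show "of_real ((D z)\<^sup>2) * herm_form H z v w = sesq M (line_coords (z - p) v) (line_coords (z - p) w)" for v w
      unfolding M(2)[OF zU, symmetric] D2 herm_form_def N_def r_def by (simp add: sum_2 algebra_simps)
    have "(D z) ^ 4 * h z = h z powr (- 4 / 3) * h z powr 1"
      using hpos[OF z] by (simp add: D_def powr_power)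
    also have "\<dots> = D z" unfolding powr_add[symmetric] D_def by simp
    finally show "D z = (D z) ^ 4 * herm_det H z" by (simp add: h_def)
  qed
qed

end

section \<open>Fubini metrics under projective transformations\<close>

definition cross_c3 :: "complex^3 \<Rightarrow> complex^3 \<Rightarrow> complex^3" where
  "cross_c3 x y = vector [x$2 * y$3 - x$3 * y$2, x$3 * y$1 - x$1 * y$3, x$1 * y$2 - x$2 * y$1]"

text \<open>
  For \<open>\<alpha> \<noteq> 0\<close> this is \<open>\<alpha>\<close> times the form dual to \<open>fubini_form \<alpha>\<close>; the factor keeps it meaningful, and of
  rank two, at \<open>\<alpha> = 0\<close>.
\<close>

definition dual_form :: "real \<Rightarrow> complex^3 \<Rightarrow> complex^3 \<Rightarrow> complex" where
  "dual_form \<alpha> x y = of_real \<alpha> * (x$1 * cnj (y$1)) + x$2 * cnj (y$2) + x$3 * cnj (y$3)"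

definition det3 :: "complex^3 \<Rightarrow> complex^3 \<Rightarrow> complex^3 \<Rightarrow> complex" where
  "det3 x y z = (\<Sum>a\<in>UNIV. x $ a * cross_c3 y z $ a)"

lemma cross_c3_nth [simp]: "cross_c3 x y $ 1 = x$2 * y$3 - x$3 * y$2" "cross_c3 x y $ 2 = x$3 * y$1 - x$1 * y$3"
  "cross_c3 x y $ 3 = x$1 * y$2 - x$2 * y$1"
  by (simp_all add: cross_c3_def)

lemma homog_nth [simp]: "homog z $ 1 = 1" "homog z $ 2 = z $ 1" "homog z $ 3 = z $ 2"
  "homog_tangent v $ 1 = 0" "homog_tangent v $ 2 = v $ 1" "homog_tangent v $ 3 = v $ 2"
  by (simp_all add: homog_def homog_tangent_def)

text \<open>
  The Gram determinant of the line coordinates of two tangent vectors; it recovers the Fubini form of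
  the point, which is how the denominator of the metric is matched.
\<close>

lemma lagrange_identity:
  "dual_form \<alpha> (cross_c3 x v) (cross_c3 x v) * dual_form \<alpha> (cross_c3 x w) (cross_c3 x w)
    - dual_form \<alpha> (cross_c3 x v) (cross_c3 x w) * dual_form \<alpha> (cross_c3 x w) (cross_c3 x v)
   = fubini_form \<alpha> x x * (det3 x v w * cnj (det3 x v w))"
  unfolding dual_form_def fubini_form_def det3_def sum_3
  by (simp only: cross_c3_nth complex_cnj_diff complex_cnj_mult complex_cnj_add) algebra

lemma fubini_gram:
  "fubini_form \<alpha> v w * fubini_form \<alpha> x x - fubini_form \<alpha> x w * fubini_form \<alpha> v x
    = of_real \<alpha> * dual_form \<alpha> (cross_c3 x v) (cross_c3 x w)"
  unfolding dual_form_def fubini_form_def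
  by (simp only: cross_c3_nth complex_cnj_diff complex_cnj_mult) algebra

lemma fubini_form_real: "fubini_form \<alpha> x x = of_real (Re (fubini_form \<alpha> x x))"
  by (simp add: fubini_form_def complex_eq_iff)

text \<open>
  The factor by which the Fubini metric differs from \<open>dual_form\<close> in line coordinates.
\<close>

definition fubini_scale :: "real \<Rightarrow> real" where "fubini_scale \<alpha> = (if \<alpha> = 0 then 1 else \<bar>\<alpha>\<bar>)"

lemma fubini_scale_pos: "fubini_scale \<alpha> > 0" by (simp add: fubini_scale_def)

text \<open>
  One formula for all \<open>\<alpha>\<close>, including the Euclidean case.
\<close>

lemma fubini_metric_line_coords:
  "fubini_metric \<alpha> x v w = fubini_scale \<alpha> * Re (dual_form \<alpha> (cross_c3 (homog x) (homog_tangent v)) (cross_c3 (homog x) (homog_tangent w)))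
      / (Re (fubini_form \<alpha> (homog x) (homog x)))\<^sup>2"
proof (cases "\<alpha> = 0")
  case True
  thus ?thesis
    by (simp add: fubini_metric_def fubini_scale_def dual_form_def fubini_form_def inner_vec_def sum_2 inner_complex_def)
next
  case False
  let ?F = "Re (fubini_form \<alpha> (homog x) (homog x))"
  have "fubini_metric \<alpha> x v w = sgn \<alpha> * Re (of_real \<alpha> * dual_form \<alpha> (cross_c3 (homog x) (homog_tangent v)) (cross_c3 (homog x) (homog_tangent w)) / (of_real ?F)\<^sup>2)"
    using False unfolding fubini_metric_def Let_def fubini_gram fubini_form_real[symmetric] by simp
  also have "\<dots> = sgn \<alpha> * \<alpha> * Re (dual_form \<alpha> (cross_c3 (homog x) (homog_tangent v)) (cross_c3 (homog x) (homog_tangent w))) / ?F\<^sup>2"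
    by (simp add: Re_divide_of_real flip: of_real_power)
  finally show ?thesis using False by (simp add: fubini_scale_def abs_sgn mult.commute)
qed

lemma has_derivative_vec_lambda:
  fixes f :: "'n::finite \<Rightarrow> 'a::real_normed_vector \<Rightarrow> 'b::euclidean_space"
  assumes "\<And>m. (f m has_derivative f' m) F"
  shows "((\<lambda>z. \<chi> m. f m z) has_derivative (\<lambda>v. \<chi> m. f' m v)) F"
proof -
  have v: "(\<chi> m. x m) = (\<Sum>m\<in>UNIV. axis m (x m))" for x :: "'n \<Rightarrow> 'b"
    by (simp add: vec_eq_iff axis_def)
  show ?thesis unfolding v
    by (intro has_derivative_sum bounded_linear.has_derivative[OF bounded_linear_axis] assms)
qed

lemma proj_map_derivative:
  fixes A :: "complex^3^3"
  assumes z: "z \<in> proj_dom A"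
  defines "Y \<equiv> A *v homog z"
  shows "frechet_derivative (proj_map A) (at z) v =
     (\<chi> m. ((A *v homog_tangent v) $ (if m = 1 then 2 else 3) - Y $ (if m = 1 then 2 else 3) * (A *v homog_tangent v) $ 1 / Y $ 1) / Y $ 1)"
proof -
  have Y1: "(A *v homog z) $ 1 \<noteq> 0" using z by (simp add: proj_dom_def)
  have d: "((\<lambda>z. (A *v homog z) $ a) has_derivative (\<lambda>v. (A *v homog_tangent v) $ a)) (at z)" for a
    unfolding matrix_vector_mult_def vec_lambda_beta sum_3 homog_nth
    using bounded_linear_imp_has_derivative[OF bounded_linear_vec_nth]
    by (auto intro!: derivative_eq_intros)
  define ix where "ix m = (if m = 1 then 2 else 3 :: 3)" for m :: 2
  have c: "((\<lambda>z. (A *v homog z) $ a / (A *v homog z) $ 1) has_derivative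
      (\<lambda>v. ((A *v homog_tangent v) $ a - (A *v homog z) $ a * (A *v homog_tangent v) $ 1 / (A *v homog z) $ 1) / (A *v homog z) $ 1)) (at z)" for a
    by (rule has_derivative_eq_rhs[OF has_derivative_divide'[OF d d Y1]])
       (use Y1 in \<open>auto simp: fun_eq_iff field_simps\<close>)
  have pm: "proj_map A = (\<lambda>z. \<chi> m. (A *v homog z) $ ix m / (A *v homog z) $ 1)"
    by (simp add: proj_map_def Let_def fun_eq_iff vec_eq_iff forall_2 ix_def)
  have "(proj_map A has_derivative (\<lambda>v. \<chi> m. ((A *v homog_tangent v) $ ix m - (A *v homog z) $ ix m * (A *v homog_tangent v) $ 1 / (A *v homog z) $ 1) / (A *v homog z) $ 1)) (at z)"
    unfolding pm by (rule has_derivative_vec_lambda[OF c])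
  thus ?thesis unfolding Y_def ix_def by (simp add: FD_eqI)
qed

text \<open>
  Passing from \<open>Y = A X\<close> to the point with first coordinate 1 divides the line coordinates by
  \<open>(Y $ 1)\<^sup>2\<close> and the Fubini form by \<open>\<bar>Y $ 1\<bar>\<^sup>2\<close>. These factors cancel in the metric.
\<close>

lemma pullback_fubini:
  fixes A :: "complex^3^3"
  assumes z: "z \<in> proj_dom A"
  defines "Y \<equiv> A *v homog z"
  shows "pullback_metric (proj_map A) (fubini_metric \<alpha>) z v w = fubini_scale \<alpha> *
     Re (dual_form \<alpha> (cross_c3 Y (A *v homog_tangent v)) (cross_c3 Y (A *v homog_tangent w))) / (Re (fubini_form \<alpha> Y Y))\<^sup>2"
    and "Re (fubini_form \<alpha> (homog (proj_map A z)) (homog (proj_map A z))) * (cmod (Y $ 1))\<^sup>2 = Re (fubini_form \<alpha> Y Y)"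
proof -
  have Y1: "Y $ 1 \<noteq> 0" using z by (simp add: proj_dom_def Y_def)
  let ?x = "proj_map A z"
  let ?d = "frechet_derivative (proj_map A) (at z)"
  let ?n = "(cmod (Y $ 1))\<^sup>2"
  have x: "?x $ 1 = Y $ 2 / Y $ 1" "?x $ 2 = Y $ 3 / Y $ 1"
    by (simp_all add: proj_map_def Let_def Y_def)
  have n: "of_real ?n = Y $ 1 * cnj (Y $ 1)" by (rule complex_norm_square)
  have n0: "?n > 0" using Y1 by simp
  show F: "Re (fubini_form \<alpha> (homog ?x) (homog ?x)) * ?n = Re (fubini_form \<alpha> Y Y)"
  proof -
    have "fubini_form \<alpha> (homog ?x) (homog ?x) * (Y $ 1 * cnj (Y $ 1)) = fubini_form \<alpha> Y Y"
      unfolding fubini_form_def homog_nth x using Y1 by (simp add: field_simps)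
    hence "Re (fubini_form \<alpha> (homog ?x) (homog ?x) * of_real ?n) = Re (fubini_form \<alpha> Y Y)" unfolding n by simp
    thus ?thesis by (simp del: of_real_power)
  qed
  have c: "cross_c3 (homog ?x) (homog_tangent (?d v)) $ a * (Y $ 1)\<^sup>2 = cross_c3 Y (A *v homog_tangent v) $ a" for v a
  proof -
    have d: "?d v $ 1 = ((A *v homog_tangent v) $ 2 - Y $ 2 * (A *v homog_tangent v) $ 1 / Y $ 1) / Y $ 1"
      "?d v $ 2 = ((A *v homog_tangent v) $ 3 - Y $ 3 * (A *v homog_tangent v) $ 1 / Y $ 1) / Y $ 1"
      unfolding proj_map_derivative[OF z] Y_def by simp_all
    have "cross_c3 (homog ?x) (homog_tangent (?d v)) $ 1 * (Y $ 1)\<^sup>2 = cross_c3 Y (A *v homog_tangent v) $ 1"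
      "cross_c3 (homog ?x) (homog_tangent (?d v)) $ 2 * (Y $ 1)\<^sup>2 = cross_c3 Y (A *v homog_tangent v) $ 2"
      "cross_c3 (homog ?x) (homog_tangent (?d v)) $ 3 * (Y $ 1)\<^sup>2 = cross_c3 Y (A *v homog_tangent v) $ 3"
      unfolding cross_c3_nth homog_nth x d using Y1 by (simp_all add: field_simps power2_eq_square)
    thus ?thesis using exhaust_3[of a] by auto
  qed
  have q: "dual_form \<alpha> (cross_c3 (homog ?x) (homog_tangent (?d v))) (cross_c3 (homog ?x) (homog_tangent (?d w))) * of_real (?n\<^sup>2)
      = dual_form \<alpha> (cross_c3 Y (A *v homog_tangent v)) (cross_c3 Y (A *v homog_tangent w))"
  proof -
    have "of_real (?n\<^sup>2) = (Y $ 1)\<^sup>2 * cnj ((Y $ 1)\<^sup>2)"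
      unfolding of_real_power[of ?n] n by (simp add: power_mult_distrib)
    thus ?thesis unfolding dual_form_def c[symmetric]
      by (simp only: complex_cnj_mult) (simp only: algebra_simps)
  qed
  have e: "Re (dual_form \<alpha> (cross_c3 (homog ?x) (homog_tangent (?d v))) (cross_c3 (homog ?x) (homog_tangent (?d w)))) * ?n\<^sup>2
      = Re (dual_form \<alpha> (cross_c3 Y (A *v homog_tangent v)) (cross_c3 Y (A *v homog_tangent w)))"
    unfolding q[symmetric] by (simp del: of_real_power)
  show "pullback_metric (proj_map A) (fubini_metric \<alpha>) z v w = fubini_scale \<alpha> *
     Re (dual_form \<alpha> (cross_c3 Y (A *v homog_tangent v)) (cross_c3 Y (A *v homog_tangent w))) / (Re (fubini_form \<alpha> Y Y))\<^sup>2"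
    unfolding pullback_metric_def fubini_metric_line_coords F[symmetric] e[symmetric] using n0
    by (simp add: power_mult_distrib)
qed

section \<open>Normal form of the solution\<close>

text \<open>
  Completing the square twice, in the coordinates \<open>k\<close> and \<open>l\<close> in this order. Positivity on the plane
  \<open>x $ n = 0\<close> makes the first two pivots positive; the sign of the third is free.
\<close>

lemma two_pivots:
  fixes M :: "3 \<Rightarrow> 3 \<Rightarrow> complex"
  assumes h: "\<And>a b. M b a = cnj (M a b)" and kln: "UNIV = {k, l, n}" "k \<noteq> l" "k \<noteq> n" "l \<noteq> n"
    and pos: "\<And>x. x \<noteq> 0 \<Longrightarrow> x $ n = 0 \<Longrightarrow> 0 < Re (sesq M x x)"
  shows "\<exists>m1 m2 m3 u v w. 0 < m1 \<and> 0 < m2 \<and> (\<forall>x y. sesq M x y =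
       of_real m1 * (x $ k + u * x $ l + v * x $ n) * cnj (y $ k + u * y $ l + v * y $ n)
       + of_real m2 * (x $ l + w * x $ n) * cnj (y $ l + w * y $ n) + of_real m3 * x $ n * cnj (y $ n))"
proof -
  have s: "(\<Sum>a\<in>UNIV. f a) = f k + f l + f n" for f :: "3 \<Rightarrow> complex"
    unfolding kln(1) using kln(2-4) by (simp add: add.assoc)
  have realI: "c = of_real (Re c)" if "cnj c = c" for c using that by (simp add: complex_eq_iff)
  define x where "x a b = (axis k a + axis l b :: complex^3)" for a b
  have xk: "x a b $ k = a" "x a b $ l = b" "x a b $ n = 0" for a b
    using kln by (auto simp: x_def axis_def)
  have S: "sesq M x y = x $ k * M k k * cnj (y $ k) + x $ k * M k l * cnj (y $ l) + x $ k * M k n * cnj (y $ n)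
     + x $ l * M l k * cnj (y $ k) + x $ l * M l l * cnj (y $ l) + x $ l * M l n * cnj (y $ n)
     + x $ n * M n k * cnj (y $ k) + x $ n * M n l * cnj (y $ l) + x $ n * M n n * cnj (y $ n)" for x y
    unfolding sesq_def s by (simp add: add.assoc)
  define m1 where "m1 = Re (M k k)"
  have k: "M k k = of_real m1" using h[of k k] by (simp add: m1_def complex_eq_iff)
  have "x 1 0 \<noteq> 0" using xk[of 1 0] by (metis zero_index zero_neq_one)
  from pos[OF this xk(3)] have m1: "m1 > 0" by (simp add: S xk k)
  define m2 where "m2 = Re (M l l - M l k * M k l / M k k)"
  have l: "M l l = of_real m2 + M l k * M k l / of_real m1"
  proof -
    have "cnj (M l l - M l k * M k l / M k k) = M l l - M l k * M k l / M k k"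
      using h[of l l] h[of l k] h[of k k] by (simp add: mult.commute)
    hence "M l l - M l k * M k l / M k k = of_real m2" unfolding m2_def by (rule realI)
    thus ?thesis unfolding k by (simp add: algebra_simps)
  qed
  (* The vector killed by the first square, on which the form equals the second pivot. *)
  have "x (- M l k / of_real m1) 1 \<noteq> 0" using xk(2)[of "- M l k / of_real m1" 1] by (metis zero_index zero_neq_one)
  from pos[OF this xk(3)] have "0 < Re (sesq M (x (- M l k / of_real m1) 1) (x (- M l k / of_real m1) 1))" .
  also have "sesq M (x (- M l k / of_real m1) 1) (x (- M l k / of_real m1) 1) = of_real m2"
    unfolding S xk k l using m1 h[of l k] by (simp add: field_simps)
  finally have m2: "m2 > 0" by simp
  define q where "q = M n l - M n k * M k l / of_real m1"
  define m3 where "m3 = Re (M n n - M n k * M k n / of_real m1 - q * cnj q / of_real m2)"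
  have n: "M n n = of_real m3 + M n k * M k n / of_real m1 + q * cnj q / of_real m2"
  proof -
    let ?e = "M n n - M n k * M k n / of_real m1 - q * cnj q / of_real m2"
    have "cnj ?e = ?e" using h[of n n] h[of n k] by (simp add: mult.commute)
    hence "?e = of_real m3" unfolding m3_def by (rule realI)
    thus ?thesis by (simp add: algebra_simps)
  qed
  have nl: "M n l = q + M n k * M k l / of_real m1" by (simp add: q_def)
  have ln: "M l n = cnj q + M l k * M k n / of_real m1"
    using h[of n l] h[of n k] h[of k l] unfolding q_def by (simp add: mult.commute)
  have "sesq M x y = of_real m1 * (x $ k + (M l k / of_real m1) * x $ l + (M n k / of_real m1) * x $ n) * cnj (y $ k + (M l k / of_real m1) * y $ l + (M n k / of_real m1) * y $ n)
       + of_real m2 * (x $ l + (q / of_real m2) * x $ n) * cnj (y $ l + (q / of_real m2) * y $ n) + of_real m3 * x $ n * cnj (y $ n)" for x y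
      unfolding S k l n nl ln h[of l k, symmetric] using m1 m2 h[of l k] h[of n k]
      by (simp add: field_simps)
  thus ?thesis using m1 m2 by (intro exI conjI allI)
qed

lemma matrix_vector_nth3:
  fixes A :: "complex^3^3"
  shows "(A *v x) $ a = A $ a $ 1 * x $ 1 + A $ a $ 2 * x $ 2 + A $ a $ 3 * x $ 3"
  by (simp add: matrix_vector_mult_def sum_3)

text \<open>
  The images are those of a basis of determinant 1, whatever the point \<open>p\<close>, so their determinant is that
  of \<open>A\<close>.
\<close>

lemma invertible_if_det3:
  fixes A :: "complex^3^3"
  assumes "det3 (A *v homog p) (A *v homog_tangent (axis 1 1)) (A *v homog_tangent (axis 2 1)) \<noteq> 0"
  shows "invertible A"
proof -
  have "det3 (A *v homog p) (A *v homog_tangent (axis 1 1)) (A *v homog_tangent (axis 2 1)) = det A"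
    unfolding det3_def sum_3 cross_c3_nth matrix_vector_nth3 homog_nth det_3 axis_def
    by (simp add: algebra_simps)
  thus ?thesis using assms by (simp add: invertible_det_nz)
qed

text \<open>
  Gaussian elimination writes \<open>M\<close> as \<open>dual_form \<alpha>\<close> in new line coordinates \<open>B x\<close>, with \<open>B\<close> triangular up to
  a permutation of the coordinates. The translation of \<open>p\<close> to the origin followed by the cofactor matrix
  of \<open>B\<close> is \<open>A\<close>; it acts on line coordinates as \<open>s\<close> times \<open>B\<close>, where \<open>s = det B\<close>. The coordinate \<open>x $ 1\<close> vanishes for the lines through
  \<open>p\<close>, so \<open>M\<close> is positive on that plane.

  The order of elimination matters. If the coordinate 1 comes last, its pivot \<open>m3\<close> is \<open>\<alpha>\<close>, of any sign.
  If it is positive, then \<open>M\<close> is positive definite and the coordinate 1 can come first: then \<open>A\<close> is affine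
  up to a factor and the line at infinity of the chart is preserved. This is needed because for \<open>\<alpha> > 0\<close>
  positivity of the Fubini form does not keep points away from that line.
\<close>

lemma normal_form_matrix:
  fixes M :: "3 \<Rightarrow> 3 \<Rightarrow> complex" and p :: "complex^2"
  assumes h: "\<And>a b. M b a = cnj (M a b)"
    and pos: "\<And>x. x \<noteq> 0 \<Longrightarrow> x $ 1 = 0 \<Longrightarrow> 0 < Re (sesq M x x)"
  shows "\<exists>(A :: complex^3^3) \<alpha> s. 0 < s
    \<and> (\<forall>z. det3 (A *v homog z) (A *v homog_tangent (axis 1 1)) (A *v homog_tangent (axis 2 1)) = of_real (s\<^sup>2))
    \<and> (\<forall>z v w. dual_form \<alpha> (cross_c3 (A *v homog z) (A *v homog_tangent v)) (cross_c3 (A *v homog z) (A *v homog_tangent w))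
        = of_real (s\<^sup>2) * sesq M (line_coords (z - p) v) (line_coords (z - p) w))
    \<and> (\<alpha> > 0 \<longrightarrow> (\<forall>z. (A *v homog z) $ 1 \<noteq> 0))"
proof -
  have U3: "UNIV = {2, 3, 1 :: 3}" "UNIV = {1, 2, 3 :: 3}" using exhaust_3 by auto
  let ?piv = "\<lambda>k l n m1 m2 m3 u v w. 0 < (m1::real) \<and> 0 < (m2::real) \<and> (\<forall>x y. sesq M x y =
       of_real m1 * (x $ k + u * x $ l + v * x $ n) * cnj (y $ k + u * y $ l + v * y $ n)
       + of_real m2 * (x $ l + w * x $ n) * cnj (y $ l + w * y $ n) + of_real m3 * x $ n * cnj (y $ n))"
  have "\<exists>m1 m2 m3 u v w. ?piv 2 3 1 m1 m2 m3 u v w"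
    by (rule two_pivots[OF h U3(1) _ _ _ pos]) simp_all
  then obtain m1 m2 m3 u v w where mm: "?piv 2 3 1 m1 m2 m3 u v w" by (elim exE) (rule that)
  note m = conjunct1[OF mm] conjunct1[OF conjunct2[OF mm]] conjunct2[OF conjunct2[OF mm], rule_format]
  show ?thesis
  proof (cases "m3 > 0")
    case False
    define s1 where "s1 = sqrt m1"
    define s2 where "s2 = sqrt m2"
    have s: "s1 > 0" "s2 > 0" "m1 = s1 * s1" "m2 = s2 * s2" using m(1,2) by (simp_all add: s1_def s2_def)
    define a where "a = of_real s1 * v"
    define b where "b = of_real s1 * u"
    define c where "c = of_real s2 * w"
    define A :: "complex^3^3" where "A = vector
      [vector [of_real (s1 * s2) + a * of_real s2 * p $ 1 + c * (of_real s1 * p $ 2 - b * p $ 1), - a * of_real s2 + c * b, - c * of_real s1],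
       vector [- of_real s2 * p $ 1, of_real s2, 0],
       vector [b * p $ 1 - of_real s1 * p $ 2, - b, of_real s1]]"
    have Y: "(A *v x) $ 1 = of_real (s1 * s2) * x $ 1 - a * of_real s2 * (x $ 2 - p $ 1 * x $ 1)
         - c * (of_real s1 * (x $ 3 - p $ 2 * x $ 1) - b * (x $ 2 - p $ 1 * x $ 1))"
      "(A *v x) $ 2 = of_real s2 * (x $ 2 - p $ 1 * x $ 1)"
      "(A *v x) $ 3 = of_real s1 * (x $ 3 - p $ 2 * x $ 1) - b * (x $ 2 - p $ 1 * x $ 1)" for x
      unfolding matrix_vector_nth3 A_def by (simp_all add: algebra_simps)
    show ?thesis
    proof (rule exI[of _ A], rule exI[of _ m3], rule exI[of _ "s1 * s2"], intro conjI allI impI)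
      show "0 < s1 * s2" using s by simp
      show "det3 (A *v homog z) (A *v homog_tangent (axis 1 1)) (A *v homog_tangent (axis 2 1)) = of_real ((s1 * s2)\<^sup>2)" for z
        unfolding det3_def sum_3 cross_c3_nth Y homog_nth axis_def by (simp add: algebra_simps power2_eq_square)
      have C: "cross_c3 (A *v homog z) (A *v homog_tangent v') $ 1 = of_real (s1 * s2) * line_coords (z - p) v' $ 1"
        "cross_c3 (A *v homog z) (A *v homog_tangent v') $ 2 = of_real (s1 * s2) * (a * line_coords (z - p) v' $ 1 + of_real s1 * line_coords (z - p) v' $ 2 + b * line_coords (z - p) v' $ 3)"
        "cross_c3 (A *v homog z) (A *v homog_tangent v') $ 3 = of_real (s1 * s2) * (c * line_coords (z - p) v' $ 1 + of_real s2 * line_coords (z - p) v' $ 3)" for z v'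
        unfolding cross_c3_nth Y homog_nth line_coords_def by (simp_all add: algebra_simps)
      show "dual_form m3 (cross_c3 (A *v homog z) (A *v homog_tangent v')) (cross_c3 (A *v homog z) (A *v homog_tangent w'))
        = of_real ((s1 * s2)\<^sup>2) * sesq M (line_coords (z - p) v') (line_coords (z - p) w')" for z v' w'
        unfolding m(3) dual_form_def C a_def b_def c_def s(3,4)
        by (simp add: algebra_simps power2_eq_square)
      show "(A *v homog z) $ 1 \<noteq> 0" if "m3 > 0" for z using that False by simp
    qed
  next
    case True
    have pos3: "0 < Re (sesq M x x)" if "x \<noteq> 0" for x
    proof -
      have r: "Re (sesq M x x) = m1 * (cmod (x $ 2 + u * x $ 3 + v * x $ 1))\<^sup>2 + m2 * (cmod (x $ 3 + w * x $ 1))\<^sup>2 + m3 * (cmod (x $ 1))\<^sup>2"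
        unfolding m(3) mult.assoc complex_norm_square[symmetric] by (simp del: of_real_power)
      show ?thesis
      proof (cases "x $ 1 = 0")
        case True thus ?thesis using pos[OF that] by simp
      next
        case False
        hence "m3 * (cmod (x $ 1))\<^sup>2 > 0" using \<open>m3 > 0\<close> by simp
        moreover have "m1 * (cmod (x $ 2 + u * x $ 3 + v * x $ 1))\<^sup>2 \<ge> 0" "m2 * (cmod (x $ 3 + w * x $ 1))\<^sup>2 \<ge> 0"
          using m(1,2) by simp_all
        ultimately show ?thesis unfolding r by linarith
      qed
    qed
    have "\<exists>m1 m2 m3 u v w. ?piv 1 2 3 m1 m2 m3 u v w"
      by (rule two_pivots[OF h U3(2)]) (simp_all add: pos3)
    then obtain n1 n2 n3 u' v' w' where nn: "?piv 1 2 3 n1 n2 n3 u' v' w'" by (elim exE) (rule that)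
    note n = conjunct1[OF nn] conjunct1[OF conjunct2[OF nn]] conjunct2[OF conjunct2[OF nn], rule_format]
    have n3: "n3 > 0"
    proof -
      define x :: "complex^3" where "x = vector [u' * w' - v', - w', 1]"
      have "x \<noteq> 0" unfolding x_def vec_eq_iff forall_3 by simp
      from pos3[OF this] show ?thesis unfolding n(3) x_def by (simp add: algebra_simps)
    qed
    define s1 where "s1 = sqrt n2"
    define s2 where "s2 = sqrt n3"
    have s: "s1 > 0" "s2 > 0" "n2 = s1 * s1" "n3 = s2 * s2" using n(2) n3 by (simp_all add: s1_def s2_def)
    define a where "a = u'"
    define c where "c = v'"
    define b where "b = of_real s1 * w'"
    define A :: "complex^3^3" where "A = vector
      [vector [of_real (s1 * s2), 0, 0],
       vector [- of_real s2 * (p $ 1 + a), of_real s2, 0],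
       vector [- of_real s1 * (p $ 2 + c) + b * (p $ 1 + a), - b, of_real s1]]"
    have Y: "(A *v x) $ 1 = of_real (s1 * s2) * x $ 1"
      "(A *v x) $ 2 = of_real s2 * (x $ 2 - (p $ 1 + a) * x $ 1)"
      "(A *v x) $ 3 = of_real s1 * (x $ 3 - (p $ 2 + c) * x $ 1) - b * (x $ 2 - (p $ 1 + a) * x $ 1)" for x
      unfolding matrix_vector_nth3 A_def by (simp_all add: algebra_simps)
    show ?thesis
    proof (rule exI[of _ A], rule exI[of _ n1], rule exI[of _ "s1 * s2"], intro conjI allI impI)
      show "0 < s1 * s2" using s by simp
      show "det3 (A *v homog z) (A *v homog_tangent (axis 1 1)) (A *v homog_tangent (axis 2 1)) = of_real ((s1 * s2)\<^sup>2)" for z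
        unfolding det3_def sum_3 cross_c3_nth Y homog_nth axis_def by (simp add: algebra_simps power2_eq_square)
      have C: "cross_c3 (A *v homog z) (A *v homog_tangent v') $ 1 = of_real (s1 * s2) * (line_coords (z - p) v' $ 1 + a * line_coords (z - p) v' $ 2 + c * line_coords (z - p) v' $ 3)"
        "cross_c3 (A *v homog z) (A *v homog_tangent v') $ 2 = of_real (s1 * s2) * (of_real s1 * line_coords (z - p) v' $ 2 + b * line_coords (z - p) v' $ 3)"
        "cross_c3 (A *v homog z) (A *v homog_tangent v') $ 3 = of_real (s1 * s2) * (of_real s2 * line_coords (z - p) v' $ 3)" for z v'
        unfolding cross_c3_nth Y homog_nth line_coords_def by (simp_all add: algebra_simps)
      show "dual_form n1 (cross_c3 (A *v homog z) (A *v homog_tangent v')) (cross_c3 (A *v homog z) (A *v homog_tangent w'))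
        = of_real ((s1 * s2)\<^sup>2) * sesq M (line_coords (z - p) v') (line_coords (z - p) w')" for z v' w'
        unfolding n(3) dual_form_def C a_def b_def c_def s(3,4)
        by (simp add: algebra_simps power2_eq_square)
      show "(A *v homog z) $ 1 \<noteq> 0" if "n1 > 0" for z using s unfolding Y by simp
    qed
  qed
qed

theorem theorem1:
  fixes \<Omega> :: "(complex^2) set"
    and g :: "complex^2 \<Rightarrow> complex^2 \<Rightarrow> complex^2 \<Rightarrow> real"
  assumes "open \<Omega>"
    and "kaehler_metric \<Omega> g"
    and "\<And>I \<gamma>. geodesic_on \<Omega> g I \<gamma> \<Longrightarrow>
           \<exists>S. (round_circle S \<or> straight_line S) \<and> \<gamma> ` I \<subseteq> S"
  shows "\<forall>U \<in> components \<Omega>. \<exists>(A :: complex^3^3) (\<alpha> :: real) (c :: real).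
           invertible A \<and> c > 0 \<and> U \<subseteq> proj_dom A \<and> proj_map A ` U \<subseteq> fubini_model \<alpha> \<and>
           (\<forall>z\<in>U. \<forall>v w. g z v w = c * pullback_metric (proj_map A) (fubini_metric \<alpha>) z v w)"
proof
  fix U assume Uc: "U \<in> components \<Omega>"
  have U: "open U" "connected U" "U \<subseteq> \<Omega>" "U \<noteq> {}"
    using Uc assms(1) open_components in_components_connected in_components_subset in_components_nonempty by blast+
  obtain p where p: "p \<in> U" using U(4) by blast
  obtain H where K: "kaehler_coefficients H \<Omega>" and g: "\<And>z v w. z \<in> \<Omega> \<Longrightarrow> g z v w = Re (herm_form H z v w)"
    using kaehler_metric_coefficients[OF assms(1,2)] by blast
  interpret kaehler_coefficients H \<Omega> by (rule K)
  let ?flat = "\<lambda>M D. (\<forall>a b. M b a = cnj (M a b)) \<and> (\<forall>z\<in>U. 0 < D z \<and> D z = (D z)^4 * herm_det H z \<and>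
    (\<forall>v w. of_real ((D z)\<^sup>2) * herm_form H z v w = sesq M (line_coords (z - p) v) (line_coords (z - p) w)))"
  have "\<exists>M D. ?flat M D"
    by (rule projectively_flat_solution[OF acceleration_along_velocity[OF _ g assms(3)] U(1-3)])
  then obtain M D where MD: "?flat M D" by (elim exE) (rule that)
  have M: "M b a = cnj (M a b)" for a b using MD by (elim conjE allE)
  have D: "0 < D z" if "z \<in> U" for z
    by (rule conjunct1[OF bspec[OF conjunct2[OF MD] that]])
  have Dd: "D z = (D z)^4 * herm_det H z" if "z \<in> U" for z
    by (rule conjunct1[OF conjunct2[OF bspec[OF conjunct2[OF MD] that]]])
  have HM: "of_real ((D z)\<^sup>2) * herm_form H z v w = sesq M (line_coords (z - p) v) (line_coords (z - p) w)" if "z \<in> U" for z v w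
    using bspec[OF conjunct2[OF MD] that] by (elim conjE allE)
  have posM: "0 < Re (sesq M x x)" if x: "x \<noteq> 0" "x $ 1 = 0" for x
  proof -
    (* Each point x of the plane x $ 1 = 0 consists of the coordinates of the line
       through p in the direction v; the metric is positive on v. *)
    define v :: "complex^2" where "v = vector [x $ 3, - x $ 2]"
    have "v \<noteq> 0" using x unfolding v_def vec_eq_iff forall_2 forall_3 by auto
    hence "0 < Re (herm_form H p v v)" using pos p U(3) by blast
    hence "0 < (D p)\<^sup>2 * Re (herm_form H p v v)" using D[OF p] by simp
    also have "\<dots> = Re (of_real ((D p)\<^sup>2) * herm_form H p v v)" by (simp del: of_real_power)
    also have "\<dots> = Re (sesq M (line_coords 0 v) (line_coords 0 v))" unfolding HM[OF p] by simp
    also have "line_coords 0 v = x" using x(2) unfolding line_coords_def v_def vec_eq_iff forall_3 by simp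
    finally show ?thesis .
  qed
  let ?normal = "\<lambda>(A :: complex^3^3) \<alpha> s. 0 < s
    \<and> (\<forall>z. det3 (A *v homog z) (A *v homog_tangent (axis 1 1)) (A *v homog_tangent (axis 2 1)) = of_real (s\<^sup>2))
    \<and> (\<forall>z v w. dual_form \<alpha> (cross_c3 (A *v homog z) (A *v homog_tangent v)) (cross_c3 (A *v homog z) (A *v homog_tangent w))
        = of_real (s\<^sup>2) * sesq M (line_coords (z - p) v) (line_coords (z - p) w))
    \<and> (\<alpha> > 0 \<longrightarrow> (\<forall>z. (A *v homog z) $ 1 \<noteq> 0))"
  have "\<exists>A \<alpha> s. ?normal A \<alpha> s" by (rule normal_form_matrix[OF M posM])
  then obtain A \<alpha> s where As: "?normal A \<alpha> s" by (elim exE) (rule that)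
  note s = conjunct1[OF As] and dA = conjunct1[OF conjunct2[OF As], rule_format]
    and qA = conjunct1[OF conjunct2[OF conjunct2[OF As]], rule_format]
    and A1 = conjunct2[OF conjunct2[OF conjunct2[OF As]], rule_format]
  have inv: "invertible A" using s by (intro invertible_if_det3[of A p]) (simp add: dA)
  (* The Gram determinants of both sides of qA: D = det N by the exponent chosen for D,
     and the left-hand side is given by lagrange_identity. *)
  have F: "Re (fubini_form \<alpha> (A *v homog z) (A *v homog z)) = D z" if z: "z \<in> U" for z
  proof -
    have z': "z \<in> \<Omega>" using z U(3) by blast
    let ?e = "\<lambda>i. line_coords (z - p) (axis i 1)"
    have hH: "herm_form H z (axis i 1) (axis j 1) = H i j z" for i j
      unfolding herm_form_def using exhaust_2[of i] exhaust_2[of j] by (auto simp: sum_2 axis_def)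
    have "of_real (s ^ 4) * fubini_form \<alpha> (A *v homog z) (A *v homog z) =
        of_real (s ^ 4) * (sesq M (?e 1) (?e 1) * sesq M (?e 2) (?e 2) - sesq M (?e 1) (?e 2) * sesq M (?e 2) (?e 1))"
      using lagrange_identity[of \<alpha> "A *v homog z" "A *v homog_tangent (axis 1 1)" "A *v homog_tangent (axis 2 1)"]
      unfolding qA dA by (simp add: algebra_simps power2_eq_square power4_eq_xxxx)
    hence "fubini_form \<alpha> (A *v homog z) (A *v homog z) =
        sesq M (?e 1) (?e 1) * sesq M (?e 2) (?e 2) - sesq M (?e 1) (?e 2) * sesq M (?e 2) (?e 1)"
      using s by simp
    also have "\<dots> = of_real ((D z) ^ 4) * (H 1 1 z * H 2 2 z - H 1 2 z * H 2 1 z)"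
      unfolding HM[OF z, symmetric] hH by (simp add: algebra_simps power2_eq_square power4_eq_xxxx)
    also have "\<dots> = of_real (D z)" unfolding herm_det_of_real[OF z', symmetric] using Dd[OF z] by (metis of_real_mult)
    finally show ?thesis by simp
  qed
  have dom: "U \<subseteq> proj_dom A"
  proof
    fix z assume z: "z \<in> U"
    have "(A *v homog z) $ 1 \<noteq> 0"
    (* For \<alpha> \<le> 0 positivity of the Fubini form already forces the first coordinate to be nonzero. *)
    proof (cases "\<alpha> > 0")
      case False
      show ?thesis
      proof
        assume 0: "(A *v homog z) $ 1 = 0"
        have "Re (fubini_form \<alpha> (A *v homog z) (A *v homog z)) = \<alpha> * ((cmod ((A *v homog z) $ 2))\<^sup>2 + (cmod ((A *v homog z) $ 3))\<^sup>2)"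
          unfolding fubini_form_def 0 complex_norm_square[symmetric] by (simp del: of_real_power)
        also have "\<dots> \<le> 0" using False by (simp add: mult_nonpos_nonneg)
        finally show False using F[OF z] D[OF z] by simp
      qed
    qed (rule A1)
    thus "z \<in> proj_dom A" by (simp add: proj_dom_def)
  qed
  have mod: "proj_map A ` U \<subseteq> fubini_model \<alpha>"
  proof
    fix x assume "x \<in> proj_map A ` U"
    then obtain z where z: "z \<in> U" "x = proj_map A z" by blast
    have "Re (fubini_form \<alpha> (homog x) (homog x)) * (cmod ((A *v homog z) $ 1))\<^sup>2 = D z"
      using pullback_fubini(2)[of z A \<alpha>] dom z F by auto
    hence "0 < Re (fubini_form \<alpha> (homog x) (homog x)) * (cmod ((A *v homog z) $ 1))\<^sup>2" using D[OF z(1)] by simp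
    hence "0 < Re (fubini_form \<alpha> (homog x) (homog x))" by (simp add: zero_less_mult_iff)
    thus "x \<in> fubini_model \<alpha>" by (simp add: fubini_model_def)
  qed
  define c where "c = 1 / (fubini_scale \<alpha> * s\<^sup>2)"
  have "c > 0" using fubini_scale_pos[of \<alpha>] s by (simp add: c_def)
  moreover have "g z v w = c * pullback_metric (proj_map A) (fubini_metric \<alpha>) z v w" if z: "z \<in> U" for z v w
  proof -
    have zd: "z \<in> proj_dom A" using dom z by blast
    have "Re (of_real (s\<^sup>2) * sesq M (line_coords (z - p) v) (line_coords (z - p) w)) = s\<^sup>2 * ((D z)\<^sup>2 * g z v w)"
      unfolding HM[OF z, symmetric] using g[of z v w] z U(3) by (auto simp del: of_real_power)
    thus ?thesis
      unfolding pullback_fubini(1)[OF zd] F[OF z] qA c_def using s D[OF z] fubini_scale_pos[of \<alpha>] by simp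
  qed
  ultimately show "\<exists>(A :: complex^3^3) (\<alpha> :: real) (c :: real).
           invertible A \<and> c > 0 \<and> U \<subseteq> proj_dom A \<and> proj_map A ` U \<subseteq> fubini_model \<alpha> \<and>
           (\<forall>z\<in>U. \<forall>v w. g z v w = c * pullback_metric (proj_map A) (fubini_metric \<alpha>) z v w)"
    using inv dom mod by blast
qed

end
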